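(* Let $\sigma=\{\pi_i \mid i\in I\}$ be a partition of the set of all primes into mutually disjoint subsets, let $G$ be a finite group and let $H$ be a subgroup of $G$. Then $H$ is $\sigma^{(3)}$-permutable in $G$ if and only if $H$ is $\sigma^{(2)}$-permutable in $G$.
   Context: All groups are finite. $\sigma=\{\pi_i \mid i\in I\}$ is a partition of the set $\mathbb{P}$ of all primes: $\pi_i\cap\pi_j=\emptyset$ for $i\neq j$ and $\bigcup_{i\in I}\pi_i=\mathbb{P}$. A subgroup $H$ of $G$ permutes with a subgroup $K$ of $G$ if $HK$ is a subgroup of $G$ (equivalently $HK=KH$). We write $P^x=x^{-1}Px$. For a set of primes $\pi$, $\mathfrak{G}_\pi$ denotes the class of all finite $\pi$-groups. A subgroup $P$ of $G$ is a $\mathfrak{G}_\pi$-projector of $G$ if, for every normal subgroup $N$ of $G$, $PN/N$ is $\mathfrak{G}_\pi$-maximal in $G/N$, i.e. $PN/N$ is a $\pi$-subgroup of $G/N$ not properly contained in any other $\pi$-subgroup of $G/N$. (Such projectors exist in every finite group.) A subgroup $H$ of $G$ is called $\sigma^{(2)}$-permutable if for every $\pi_i\in\sigma$ it permutes with every $\mathfrak{G}_{\pi_i}$-projector of $G$. A subgroup $H$ of $G$ is called $\sigma^{(3)}$-permutable if for every $\pi_i\in\sigma$ there is a $\mathfrak{G}_{\pi_i}$-projector $P$ of $G$ such that $HP^x=P^xH$ for all $x\in G$. *)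

theory Defs
  imports
    "HOL-Algebra.Coset"
    "HOL-Computational_Algebra.Primes"
    "HOL-Library.Disjoint_Sets"
begin

text \<open>
  The partition is an indexed family \<open>\<pi>\<close> over an index set \<open>I\<close>; blocks \<open>\<pi> i\<close> may be empty.
\<close>

definition prime_partition :: "'i set \<Rightarrow> ('i \<Rightarrow> nat set) \<Rightarrow> bool" where
  "prime_partition I \<pi> \<longleftrightarrow>
     disjoint_family_on \<pi> I \<and> (\<Union>i\<in>I. \<pi> i) = {p. prime p}"

definition pi_group :: "nat set \<Rightarrow> ('a, 'b) monoid_scheme \<Rightarrow> bool" where
  "pi_group \<pi> G \<longleftrightarrow> group G \<and> finite (carrier G) \<and> prime_factors (order G) \<subseteq> \<pi>"

definition pi_subgroup :: "nat set \<Rightarrow> ('a, 'b) monoid_scheme \<Rightarrow> 'a set \<Rightarrow> bool" where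
  "pi_subgroup \<pi> G P \<longleftrightarrow> subgroup P G \<and> pi_group \<pi> (G\<lparr>carrier := P\<rparr>)"

definition pi_maximal :: "nat set \<Rightarrow> ('a, 'b) monoid_scheme \<Rightarrow> 'a set \<Rightarrow> bool" where
  "pi_maximal \<pi> G P \<longleftrightarrow>
     pi_subgroup \<pi> G P \<and> (\<nexists>Q. pi_subgroup \<pi> G Q \<and> P \<subset> Q)"

text \<open>
  The set \<open>rcosets\<^bsub>G\<lparr>carrier := P <#>\<^bsub>G\<^esub> N\<rparr>\<^esub> N\<close> consists of the cosets of \<open>N\<close> by elements
  of \<open>PN\<close>, so it is \<open>PN/N\<close> as a subset of the carrier of \<open>G Mod N\<close>.
\<close>

definition pi_projector :: "nat set \<Rightarrow> ('a, 'b) monoid_scheme \<Rightarrow> 'a set \<Rightarrow> bool" where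
  "pi_projector \<pi> G P \<longleftrightarrow>
     subgroup P G \<and>
     (\<forall>N. N \<lhd> G \<longrightarrow> pi_maximal \<pi> (G Mod N) (rcosets\<^bsub>G\<lparr>carrier := P <#>\<^bsub>G\<^esub> N\<rparr>\<^esub> N))"

definition permutes_with :: "('a, 'b) monoid_scheme \<Rightarrow> 'a set \<Rightarrow> 'a set \<Rightarrow> bool" where
  "permutes_with G H K \<longleftrightarrow> subgroup (H <#>\<^bsub>G\<^esub> K) G"

definition conj_subset :: "('a, 'b) monoid_scheme \<Rightarrow> 'a set \<Rightarrow> 'a \<Rightarrow> 'a set" where
  "conj_subset G P x = (inv\<^bsub>G\<^esub> x <#\<^bsub>G\<^esub> P) #>\<^bsub>G\<^esub> x"

definition sigma2_permutable ::
    "'i set \<Rightarrow> ('i \<Rightarrow> nat set) \<Rightarrow> ('a, 'b) monoid_scheme \<Rightarrow> 'a set \<Rightarrow> bool" where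
  "sigma2_permutable I \<pi> G H \<longleftrightarrow>
     (\<forall>i\<in>I. \<forall>P. pi_projector (\<pi> i) G P \<longrightarrow> permutes_with G H P)"

definition sigma3_permutable ::
    "'i set \<Rightarrow> ('i \<Rightarrow> nat set) \<Rightarrow> ('a, 'b) monoid_scheme \<Rightarrow> 'a set \<Rightarrow> bool" where
  "sigma3_permutable I \<pi> G H \<longleftrightarrow>
     (\<forall>i\<in>I. \<exists>P. pi_projector (\<pi> i) G P \<and>
        (\<forall>x\<in>carrier G. H <#>\<^bsub>G\<^esub> conj_subset G P x = conj_subset G P x <#>\<^bsub>G\<^esub> H))"

end

theory Submission
  imports Defs "HOL-Algebra.Sylow" "HOL-Algebra.Elementary_Groups" "HOL-Algebra.Multiplicative_Group"
begin

text \<open>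
  Conjugates of a projector are projectors. Hence a \<open>\<sigma>\<^sup>(\<^sup>2\<^sup>)\<close>-permutable subgroup is
  \<open>\<sigma>\<^sup>(\<^sup>3\<^sup>)\<close>-permutable as soon as every finite group has a \<open>\<pi>\<close>-projector for every set \<open>\<pi>\<close> of primes
  (\<open>pi_projector_exists\<close>).

  For the converse fix a block \<open>\<pi>\<close> of the partition. Let \<open>\<P>\<close> consist of the conjugates of the given
  projector for \<open>\<pi>\<close> and \<open>\<Q>\<close> of those of the given projectors for the other blocks; \<open>H\<close> permutes with
  all of them. Because projectors stay maximal in quotients, \<open>\<P>\<close> generates a subgroup that contains
  every \<open>\<pi>\<close>-subgroup of \<open>G\<close> (\<open>pi_subgroup_in_closure_of_projector\<close>), and likewise for \<open>\<Q>\<close> and the other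
  blocks. If \<open>b \<in> P \<in> \<P>\<close>, then \<open>\<langle>H, bHb\<^sup>-\<^sup>1\<rangle>\<close> lies in the subgroup \<open>HP\<close>, and it still permutes with
  everything that \<open>H\<close> was assumed to permute with. Iterating, one sees that the closure \<open>A\<close> of \<open>H\<close> under
  conjugation by \<open>\<P>\<close> has \<open>\<pi>\<close>-index over \<open>H\<close>, and that the closure \<open>B\<close> under \<open>\<Q>\<close> has \<open>\<pi>'\<close>-index
  (\<open>closure_under_conjugation\<close>); in particular \<open>A \<inter> B = H\<close>. Closing \<open>A\<close> under \<open>\<Q>\<close>, or \<open>B\<close> under \<open>\<P>\<close>,
  yields the normal closure \<open>M\<close> of \<open>H\<close>, so \<open>\<bar>M : A\<bar>\<close> is a \<open>\<pi>'\<close>-number and \<open>\<bar>M : B\<bar>\<close> a \<open>\<pi>\<close>-number. The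
  \<open>\<pi>\<close>-elements of \<open>M\<close> normalize \<open>A\<close>, hence lie in \<open>A\<close> for reasons of order; let \<open>U \<subseteq> A\<close> be the subgroup
  that they generate, and \<open>V \<subseteq> B\<close> the one generated by the \<open>\<pi>'\<close>-elements. Both are normal in \<open>G\<close>, their
  intersection \<open>D\<close> is contained in \<open>A \<inter> B = H\<close>, and \<open>M/D\<close> is the direct product of the \<open>\<pi>\<close>-group
  \<open>U/D\<close> and the \<open>\<pi>'\<close>-group \<open>V/D\<close>. Therefore \<open>H = (H \<inter> V)(H \<inter> U)\<close>.

  Now let \<open>E\<close> be any projector for \<open>\<pi>\<close>. Maximality of \<open>ED/D\<close> gives \<open>U \<subseteq> ED\<close>. On the other hand
  \<open>H \<inter> V = A \<inter> V\<close> is normalized by \<open>E\<close>, since \<open>E\<close> lies in the group generated by \<open>\<P>\<close>. As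
  \<open>D \<subseteq> H \<inter> V\<close>, it follows that \<open>HE = (H \<inter> V)E\<close> is a subgroup (\<open>permutes_with_projector\<close>).

  Projectors of a section \<open>X/K\<close> are found by induction on its size. If a proper quotient \<open>X/N\<close> is not
  a \<open>\<pi>\<close>-group, its projectors are proper subgroups \<open>E/N\<close>, and projectors of \<open>E/K\<close> are projectors of \<open>X/K\<close>
  (\<open>section_projector_trans\<close>). If all proper quotients are \<open>\<pi>\<close>-groups, what is needed is a \<open>\<pi>\<close>-subgroup
  that covers them (\<open>pi_supplement\<close>); it comes from the Frattini argument and the theorem of Schur and
  Zassenhaus for abelian normal subgroups, applied to a Sylow subgroup modulo its derived subgroup.
\<close>

section \<open>Orders of subgroups, one prime at a time\<close>

text \<open>
  Orders of subgroups are compared through their \<open>q\<close>-parts \<open>q ^ val q A\<close>. An index that is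
  a \<open>\<pi>\<close>-number is thereby an equality of \<open>val q\<close> at all primes \<open>q \<notin> \<pi>\<close>, which composes along chains
  of subgroups and combines with \<open>val_product\<close> by linear arithmetic.
\<close>

abbreviation val :: "nat \<Rightarrow> 'a set \<Rightarrow> nat" where
  "val q A \<equiv> multiplicity q (card A)"

lemma multiplicity_eq_0_iff_prime_factors:
  assumes "(n::nat) > 0"
  shows "prime_factors n \<subseteq> \<pi> \<longleftrightarrow> (\<forall>q. prime q \<longrightarrow> q \<notin> \<pi> \<longrightarrow> multiplicity q n = 0)"
  by (metis assms count_prime_factorization_nonprime count_prime_factorization_prime
      in_prime_factors_imp_prime not_in_iff subset_iff)

locale finite_group = group +
  assumes fin [simp, intro]: "finite (carrier G)"
begin

lemma finite_subgroup: "subgroup A G \<Longrightarrow> finite A"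
  using finite_subset[OF subgroup.subset fin] .

lemma card_subgroup_pos: "subgroup A G \<Longrightarrow> card A > 0"
  using finite_subgroup subgroup.one_closed by (auto simp: card_gt_0_iff)

lemma subgroup_inter: "subgroup A G \<Longrightarrow> subgroup B G \<Longrightarrow> subgroup (A \<inter> B) G"
  by (rule subgroups_Inter_pair)

lemma finite_group_subgroup: "subgroup A G \<Longrightarrow> finite_group (G\<lparr>carrier := A\<rparr>)"
  using subgroup_imp_group finite_subgroup by (simp add: finite_group_def finite_group_axioms_def)

lemma subgroup_of_subgroup_iff:
  assumes "subgroup Y G"
  shows "subgroup X (G\<lparr>carrier := Y\<rparr>) \<longleftrightarrow> subgroup X G \<and> X \<subseteq> Y"
proof
  assume X: "subgroup X (G\<lparr>carrier := Y\<rparr>)"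
  show "subgroup X G \<and> X \<subseteq> Y" using incl_subgroup[OF assms X] subgroup.subset[OF X] by simp
next
  assume "subgroup X G \<and> X \<subseteq> Y"
  then show "subgroup X (G\<lparr>carrier := Y\<rparr>)" using subgroup_incl assms by blast
qed

lemma card_dvd_subgroup:
  assumes "subgroup A G" "subgroup B G" "A \<subseteq> B"
  shows "card A dvd card B"
proof -
  interpret B: group "G\<lparr>carrier := B\<rparr>" using assms subgroup_imp_group by blast
  have "subgroup A (G\<lparr>carrier := B\<rparr>)" using assms subgroup_of_subgroup_iff by blast
  from B.lagrange[OF this] show ?thesis
    unfolding order_def by simp (metis dvd_triv_right)
qed

lemma card_subgroup_product:
  assumes H: "subgroup H G" and K: "subgroup K G"
  shows "card (H <#> K) * card (H \<inter> K) = card H * card K"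
proof -
  have Hc: "H \<subseteq> carrier G" and Kc: "K \<subseteq> carrier G" using assms subgroup.subset by auto
  define f where "f = (\<lambda>(h, k). h \<otimes> k)"
  have im: "f ` (H \<times> K) = H <#> K" unfolding f_def set_mult_def by auto
  have fibre: "card {p \<in> H \<times> K. f p = y} = card (H \<inter> K)" if "y \<in> H <#> K" for y
  proof -
    from that obtain h k where hk: "h \<in> H" "k \<in> K" "y = h \<otimes> k" unfolding set_mult_def by auto
    have c: "h \<in> carrier G" "k \<in> carrier G" using hk Hc Kc by auto
    \<comment> \<open>The other factorizations of \<open>h \<otimes> k\<close> arise by moving an element of \<open>H \<inter> K\<close> across.\<close>
    have "bij_betw (\<lambda>d. (h \<otimes> d, inv d \<otimes> k)) (H \<inter> K) {p \<in> H \<times> K. f p = y}"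
    proof (rule bij_betw_imageI)
      show "inj_on (\<lambda>d. (h \<otimes> d, inv d \<otimes> k)) (H \<inter> K)"
        by (rule inj_onI) (metis IntD1 Hc Units_eq Units_l_cancel c(1) fst_conv subsetD)
      show "(\<lambda>d. (h \<otimes> d, inv d \<otimes> k)) ` (H \<inter> K) = {p \<in> H \<times> K. f p = y}" (is "?L = ?R")
      proof
        show "?L \<subseteq> ?R"
        proof
          fix p assume "p \<in> ?L"
          then obtain d where d: "d \<in> H" "d \<in> K" "p = (h \<otimes> d, inv d \<otimes> k)" by auto
          have dc: "d \<in> carrier G" using d Hc by auto
          have "h \<otimes> d \<otimes> (inv d \<otimes> k) = h \<otimes> k"
            using dc c by (metis inv_closed inv_solve_right m_assoc m_closed)
          then show "p \<in> ?R" using d hk H K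
            by (auto simp: f_def subgroup.m_closed subgroup.m_inv_closed)
        qed
        show "?R \<subseteq> ?L"
        proof
          fix p assume "p \<in> ?R"
          then obtain h' k' where p: "p = (h', k')" "h' \<in> H" "k' \<in> K" "h' \<otimes> k' = h \<otimes> k"
            using hk by (auto simp: f_def)
          have c': "h' \<in> carrier G" "k' \<in> carrier G" using p Hc Kc by auto
          have e: "inv h \<otimes> h' = k \<otimes> inv k'"
            using p(4) c c' by (metis inv_solve_left inv_solve_right m_assoc m_closed inv_closed)
          have "inv h \<otimes> h' \<in> H \<inter> K"
            using e p hk H K by (metis IntI subgroup.m_closed subgroup.m_inv_closed)
          moreover have "h \<otimes> (inv h \<otimes> h') = h'" using c c' by (simp add: m_assoc[symmetric])
          moreover have "inv (inv h \<otimes> h') \<otimes> k = k'"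
            unfolding e using c c' by (simp add: inv_mult_group m_assoc)
          ultimately show "p \<in> ?L" using p by (intro image_eqI[of _ _ "inv h \<otimes> h'"]) auto
        qed
      qed
    qed
    from bij_betw_same_card[OF this] show ?thesis by simp
  qed
  have finHK: "finite (H \<times> K)" using assms finite_subgroup by auto
  have "card (H \<times> K) = (\<Sum>y\<in>H <#> K. card {p \<in> H \<times> K. f p = y})"
    using sum.image_gen[OF finHK, of "\<lambda>_. 1::nat" f] im by simp
  also have "\<dots> = card (H <#> K) * card (H \<inter> K)" using fibre by simp
  finally show ?thesis by (simp add: card_cartesian_product)
qed

lemma val_product:
  assumes "subgroup H G" "subgroup K G" "prime q"
  shows "val q (H <#> K) + val q (H \<inter> K) = val q H + val q K"
proof -
  have 0: "card H > 0" "card K > 0" "card (H \<inter> K) > 0"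
    using assms card_subgroup_pos subgroup_inter by auto
  have e: "card (H <#> K) * card (H \<inter> K) = card H * card K" using card_subgroup_product assms by auto
  then have 1: "card (H <#> K) > 0" using 0 by (metis mult_eq_0_iff neq0_conv)
  have "multiplicity q (card (H <#> K) * card (H \<inter> K)) = multiplicity q (card H * card K)" using e by simp
  then show ?thesis using 0 1 assms(3) by (simp add: prime_elem_multiplicity_mult_distrib)
qed

lemma val_product_le:
  assumes "subgroup H G" "subgroup K G" "prime q"
  shows "val q (H <#> K) \<le> val q H + val q K"
  using val_product[OF assms] by simp

lemma val_mono:
  assumes "subgroup A G" "subgroup B G" "A \<subseteq> B"
  shows "val q A \<le> val q B"
  using card_dvd_subgroup[OF assms] card_subgroup_pos[OF assms(2)]
  by (simp add: dvd_imp_multiplicity_le)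

lemma subgroup_eqI_val:
  assumes "subgroup A G" "subgroup B G" "A \<subseteq> B"
    and "\<And>q. prime q \<Longrightarrow> val q B \<le> val q A"
  shows "A = B"
proof -
  have "card A = card B"
  proof (rule multiplicity_eq_nat)
    show "card A > 0" "card B > 0" using assms card_subgroup_pos by blast+
    show "val q A = val q B" if "prime q" for q
      using val_mono[OF assms(1-3), of q] assms(4)[OF that] by (rule antisym)
  qed
  with card_subset_eq[OF finite_subgroup[OF assms(2)] assms(3)] show ?thesis .
qed

lemma sylow_exists:
  assumes "subgroup Y G" "prime q"
  obtains S where "subgroup S G" "S \<subseteq> Y" "card S = q ^ val q Y"
proof -
  interpret Y: finite_group "G\<lparr>carrier := Y\<rparr>" using finite_group_subgroup assms by blast
  obtain m where "card Y = q ^ val q Y * m" using multiplicity_dvd by (metis dvdE)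
  then have "order (G\<lparr>carrier := Y\<rparr>) = q ^ val q Y * m" by (simp add: order_def)
  from sylow_thm[OF assms(2) Y.is_group this Y.fin] that assms show ?thesis
    by (auto simp: subgroup_of_subgroup_iff)
qed

definition q_element :: "nat \<Rightarrow> 'a \<Rightarrow> bool" where
  "q_element q y \<longleftrightarrow> y \<in> carrier G \<and> (\<exists>a. y [^] (q ^ a :: nat) = \<one>)"

lemma pow_card_eq_one:
  assumes "subgroup A G" "x \<in> A" shows "x [^] card A = \<one>"
proof -
  interpret A: finite_group "G\<lparr>carrier := A\<rparr>" using finite_group_subgroup assms by blast
  have "x [^]\<^bsub>G\<lparr>carrier := A\<rparr>\<^esub> order (G\<lparr>carrier := A\<rparr>) = \<one>\<^bsub>G\<lparr>carrier := A\<rparr>\<^esub>"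
    using A.pow_order_eq_1 assms by auto
  then show ?thesis by (simp add: order_def nat_pow_consistent[symmetric])
qed

text \<open>
  A Sylow \<open>q\<close>-subgroup of \<open>Y\<close> consists of \<open>q\<close>-elements, so \<open>X\<close> contains one. This is how a
  subgroup known only through the elements it contains is shown to have large order.
\<close>

lemma val_eqI_q_elements:
  assumes X: "subgroup X G" and Y: "subgroup Y G" and "X \<subseteq> Y" "prime q"
    and el: "\<And>y. y \<in> Y \<Longrightarrow> q_element q y \<Longrightarrow> y \<in> X"
  shows "val q X = val q Y"
proof -
  obtain S where S: "subgroup S G" "S \<subseteq> Y" "card S = q ^ val q Y" using sylow_exists Y \<open>prime q\<close> by blast
  have "S \<subseteq> X"
  proof
    fix s assume s: "s \<in> S"
    then have "s \<in> carrier G" using S subgroup.subset by blast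
    then have "q_element q s"
      using pow_card_eq_one[OF S(1) s] S(3) by (auto simp: q_element_def)
    then show "s \<in> X" using el s S by auto
  qed
  then have "val q S \<le> val q X" by (rule val_mono[OF S(1) X])
  moreover have "val q S = val q Y" using S(3) \<open>prime q\<close> by simp
  ultimately show ?thesis using val_mono[OF X Y \<open>X \<subseteq> Y\<close>, of q] by simp
qed

lemma val_cyclic_q_element:
  assumes "q_element q x" "prime q" "prime p" "p \<noteq> q"
  shows "val p (generate G {x}) = 0"
proof -
  obtain a where a: "x \<in> carrier G" "x [^] (q ^ a :: nat) = \<one>" using assms q_element_def by auto
  have "ord x dvd q ^ a" using a pow_eq_id by simp
  then have "\<not> p dvd ord x" using assms by (metis dvd_trans prime_dvd_power primes_dvd_imp_eq)
  then show ?thesis using generate_pow_card[OF a(1)] by (simp add: not_dvd_imp_multiplicity_0)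
qed

section \<open>Conjugation, normalizers and permuting subgroups\<close>

text \<open>
  For a finite set \<open>L\<close> the inclusion \<open>gLg\<^sup>-\<^sup>1 \<subseteq> L\<close> is an equality, so this is the normalizer of \<open>L\<close>.
\<close>

definition normalizing :: "'a set \<Rightarrow> 'a set" where
  "normalizing L = {g \<in> carrier G. \<forall>l\<in>L. g \<otimes> l \<otimes> inv g \<in> L}"

lemma normalizing_subset: "normalizing L \<subseteq> carrier G"
  by (auto simp: normalizing_def)

lemma normalizingD: "g \<in> normalizing L \<Longrightarrow> l \<in> L \<Longrightarrow> g \<otimes> l \<otimes> inv g \<in> L"
  by (auto simp: normalizing_def)

lemma conj_mult:
  "\<lbrakk>g \<in> carrier G; h \<in> carrier G; x \<in> carrier G\<rbrakk> \<Longrightarrow>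
   (g \<otimes> h) \<otimes> x \<otimes> inv (g \<otimes> h) = g \<otimes> (h \<otimes> x \<otimes> inv h) \<otimes> inv g"
  by (simp add: inv_mult_group m_assoc)

lemma conj_distrib:
  "\<lbrakk>g \<in> carrier G; x \<in> carrier G; y \<in> carrier G\<rbrakk> \<Longrightarrow>
   g \<otimes> (x \<otimes> y) \<otimes> inv g = (g \<otimes> x \<otimes> inv g) \<otimes> (g \<otimes> y \<otimes> inv g)"
  by (simp add: m_assoc) (metis inv_closed l_inv l_one m_assoc m_closed)

lemma inv_conj_conj:
  "\<lbrakk>g \<in> carrier G; x \<in> carrier G\<rbrakk> \<Longrightarrow> inv g \<otimes> (g \<otimes> x \<otimes> inv g) \<otimes> g = x"
  by (simp add: m_assoc) (simp add: m_assoc[symmetric])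

definition conjugate :: "'a \<Rightarrow> 'a set \<Rightarrow> 'a set" where
  "conjugate g L = (\<lambda>x. g \<otimes> x \<otimes> inv g) ` L"

lemma conjugate_inj: "g \<in> carrier G \<Longrightarrow> L \<subseteq> carrier G \<Longrightarrow> inj_on (\<lambda>x. g \<otimes> x \<otimes> inv g) L"
  using inv_conj_conj[of g] by (intro inj_onI) (metis subsetD)

lemma card_conjugate: "g \<in> carrier G \<Longrightarrow> L \<subseteq> carrier G \<Longrightarrow> card (conjugate g L) = card L"
  by (simp add: conjugate_def card_image conjugate_inj)

lemma conjugate_closed: "g \<in> carrier G \<Longrightarrow> L \<subseteq> carrier G \<Longrightarrow> conjugate g L \<subseteq> carrier G"
  by (auto simp: conjugate_def)

lemma conjugate_conjugate:
  assumes "g \<in> carrier G" "h \<in> carrier G" "L \<subseteq> carrier G"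
  shows "conjugate g (conjugate h L) = conjugate (g \<otimes> h) L"
proof -
  have "x \<in> L \<Longrightarrow> g \<otimes> (h \<otimes> x \<otimes> inv h) \<otimes> inv g = g \<otimes> h \<otimes> x \<otimes> inv (g \<otimes> h)" for x
    using conj_mult[of g h x] assms by auto
  then show ?thesis unfolding conjugate_def image_image by (intro image_cong) auto
qed

lemma conjugate_one: "L \<subseteq> carrier G \<Longrightarrow> conjugate \<one> L = L"
  by (force simp: conjugate_def)

lemma conjugate_conjugate_inv: "g \<in> carrier G \<Longrightarrow> L \<subseteq> carrier G \<Longrightarrow> conjugate g (conjugate (inv g) L) = L"
  "g \<in> carrier G \<Longrightarrow> L \<subseteq> carrier G \<Longrightarrow> conjugate (inv g) (conjugate g L) = L"
  by (simp_all add: conjugate_conjugate conjugate_one)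

lemma conjugate_mono: "A \<subseteq> B \<Longrightarrow> conjugate g A \<subseteq> conjugate g B"
  by (auto simp: conjugate_def)

lemma subgroup_conjugate:
  assumes "g \<in> carrier G" "subgroup L G"
  shows "subgroup (conjugate g L) G"
proof (rule subgroupI)
  have c: "L \<subseteq> carrier G" using assms subgroup.subset by auto
  show "conjugate g L \<subseteq> carrier G" by (rule conjugate_closed[OF assms(1) c])
  show "conjugate g L \<noteq> {}" using subgroup.one_closed[OF assms(2)] by (auto simp: conjugate_def)
  fix a assume "a \<in> conjugate g L"
  then obtain l where l: "l \<in> L" "a = g \<otimes> l \<otimes> inv g" by (auto simp: conjugate_def)
  have "inv a = g \<otimes> inv l \<otimes> inv g" using l assms c by (auto simp: inv_mult_group m_assoc)
  then show "inv a \<in> conjugate g L" using subgroup.m_inv_closed[OF assms(2) l(1)] by (simp add: conjugate_def)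
  fix b assume "b \<in> conjugate g L"
  then obtain k where k: "k \<in> L" "b = g \<otimes> k \<otimes> inv g" by (auto simp: conjugate_def)
  have "a \<otimes> b = g \<otimes> (l \<otimes> k) \<otimes> inv g"
    unfolding l(2) k(2) using conj_distrib[OF assms(1) subsetD[OF c l(1)] subsetD[OF c k(1)]] by (rule sym)
  then show "a \<otimes> b \<in> conjugate g L" using subgroup.m_closed[OF assms(2) l(1) k(1)] by (simp add: conjugate_def)
qed

lemma normalizing_iff: "g \<in> normalizing L \<longleftrightarrow> g \<in> carrier G \<and> conjugate g L \<subseteq> L"
  by (auto simp: normalizing_def conjugate_def)

lemma normalizing_conjugate_eq:
  assumes "g \<in> normalizing L" "L \<subseteq> carrier G"
  shows "conjugate g L = L"
proof -
  have "finite L" using assms finite_subset by blast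
  moreover have "conjugate g L \<subseteq> L" "card (conjugate g L) = card L"
    using assms card_conjugate normalizing_iff by auto
  ultimately show ?thesis by (rule card_subset_eq)
qed

lemma subgroup_normalizing:
  assumes L: "L \<subseteq> carrier G"
  shows "subgroup (normalizing L) G"
proof (rule subgroupI)
  show "normalizing L \<subseteq> carrier G" by (rule normalizing_subset)
  show "normalizing L \<noteq> {}" using conjugate_one[OF L] normalizing_iff[of \<one> L] by auto
  fix a assume a: "a \<in> normalizing L"
  then have "conjugate (inv a) L = L" "a \<in> carrier G"
    using normalizing_conjugate_eq[OF a L] conjugate_conjugate_inv(2)[of a L] L by (auto simp: normalizing_iff)
  then show "inv a \<in> normalizing L" by (simp add: normalizing_iff)
  fix b assume b: "b \<in> normalizing L"
  then show "a \<otimes> b \<in> normalizing L"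
    using a conjugate_conjugate[of a b L] L normalizing_conjugate_eq[OF a L] normalizing_conjugate_eq[OF b L]
    by (simp add: normalizing_iff)
qed

lemma subgroup_subset_normalizing: "subgroup L G \<Longrightarrow> L \<subseteq> normalizing L"
  using subgroup.subset[of L G]
  by (auto simp: normalizing_def intro: subgroup.m_closed subgroup.m_inv_closed)

lemma normal_iff_normalizing: "N \<lhd> G \<longleftrightarrow> subgroup N G \<and> carrier G \<subseteq> normalizing N"
  by (auto simp: normal_inv_iff normalizing_def)

lemma permute_swap:
  assumes H: "subgroup H G" and K: "subgroup K G" and s: "subgroup (H <#> K) G"
  shows "H <#> K = K <#> H"
proof -
  have Hc: "H \<subseteq> carrier G" and Kc: "K \<subseteq> carrier G" using assms subgroup.subset by auto
  have "K <#> H \<subseteq> H <#> K"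
  proof
    fix x assume "x \<in> K <#> H"
    then obtain k h where x: "k \<in> K" "h \<in> H" "x = k \<otimes> h" unfolding set_mult_def by auto
    have "inv h \<otimes> inv k \<in> H <#> K"
      using subgroup.m_inv_closed[OF H x(2)] subgroup.m_inv_closed[OF K x(1)]
      unfolding set_mult_def by blast
    then have "inv (inv h \<otimes> inv k) \<in> H <#> K" by (rule subgroup.m_inv_closed[OF s])
    moreover have "inv (inv h \<otimes> inv k) = x"
      using x subsetD[OF Hc x(2)] subsetD[OF Kc x(1)] by (simp add: inv_mult_group)
    ultimately show "x \<in> H <#> K" by simp
  qed
  moreover have "card (K <#> H) * card (H \<inter> K) = card (H <#> K) * card (H \<inter> K)"
    using card_subgroup_product[OF H K] card_subgroup_product[OF K H]
    by (simp add: Int_commute mult.commute[of "card K"])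
  then have "card (K <#> H) = card (H <#> K)"
    using card_subgroup_pos[OF subgroup_inter[OF H K]] by simp
  ultimately have "K <#> H = H <#> K" by (rule card_subset_eq[OF finite_subgroup[OF s]])
  then show ?thesis by (rule sym)
qed

lemma subgroup_productI:
  assumes H: "subgroup H G" and K: "subgroup K G" and s: "K <#> H \<subseteq> H <#> K"
  shows "subgroup (H <#> K) G"
proof (rule subgroupI)
  have Hc: "H \<subseteq> carrier G" and Kc: "K \<subseteq> carrier G" using assms subgroup.subset by auto
  show "H <#> K \<subseteq> carrier G" using Hc Kc setmult_subset_G by auto
  show "H <#> K \<noteq> {}"
    using subgroup.one_closed[OF H] subgroup.one_closed[OF K] unfolding set_mult_def by blast
  fix a assume "a \<in> H <#> K"
  then obtain h k where a: "h \<in> H" "k \<in> K" "a = h \<otimes> k" unfolding set_mult_def by auto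
  have "inv a = inv k \<otimes> inv h"
    using a subsetD[OF Hc a(1)] subsetD[OF Kc a(2)] by (simp add: inv_mult_group)
  then have "inv a \<in> K <#> H"
    using subgroup.m_inv_closed[OF H a(1)] subgroup.m_inv_closed[OF K a(2)]
    unfolding set_mult_def by blast
  then show "inv a \<in> H <#> K" using s by auto
  fix b assume "b \<in> H <#> K"
  then obtain h' k' where b: "h' \<in> H" "k' \<in> K" "b = h' \<otimes> k'" unfolding set_mult_def by auto
  have "k \<otimes> h' \<in> K <#> H" using a b unfolding set_mult_def by auto
  then have "k \<otimes> h' \<in> H <#> K" using s by blast
  then obtain h2 k2 where e: "h2 \<in> H" "k2 \<in> K" "k \<otimes> h' = h2 \<otimes> k2" unfolding set_mult_def by auto
  have c: "h \<in> carrier G" "k \<in> carrier G" "h' \<in> carrier G" "k' \<in> carrier G" "h2 \<in> carrier G" "k2 \<in> carrier G"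
    using a b e Hc Kc by auto
  have "a \<otimes> b = h \<otimes> (k \<otimes> h') \<otimes> k'" using a b c by (simp add: m_assoc)
  also have "\<dots> = (h \<otimes> h2) \<otimes> (k2 \<otimes> k')" using e c by (simp add: m_assoc)
  finally show "a \<otimes> b \<in> H <#> K"
    using subgroup.m_closed[OF H a(1) e(1)] subgroup.m_closed[OF K e(2) b(2)]
    unfolding set_mult_def by blast
qed

lemma subgroup_product_normalizing:
  assumes H: "subgroup H G" and K: "subgroup K G" and s: "K \<subseteq> normalizing H"
  shows "subgroup (H <#> K) G"
proof (rule subgroup_productI[OF H K], rule subsetI)
  fix x assume "x \<in> K <#> H"
  then obtain k h where x: "k \<in> K" "h \<in> H" "x = k \<otimes> h" unfolding set_mult_def by auto
  have c: "k \<in> carrier G" "h \<in> carrier G"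
    using subgroup.mem_carrier[OF K x(1)] subgroup.mem_carrier[OF H x(2)] by auto
  have "x = (k \<otimes> h \<otimes> inv k) \<otimes> k" using x c by (simp add: m_assoc)
  moreover have "k \<otimes> h \<otimes> inv k \<in> H" using normalizingD[OF subsetD[OF s x(1)] x(2)] .
  ultimately show "x \<in> H <#> K" using x unfolding set_mult_def by blast
qed

lemma subset_product_left: "subgroup K G \<Longrightarrow> H \<subseteq> carrier G \<Longrightarrow> H \<subseteq> H <#> K"
  using subgroup.one_closed[of K G] by (force simp: set_mult_def)

lemma subset_product_right: "subgroup H G \<Longrightarrow> K \<subseteq> carrier G \<Longrightarrow> K \<subseteq> H <#> K"
  using subgroup.one_closed[of H G] by (force simp: set_mult_def)

lemma product_subset_subgroup: "subgroup L G \<Longrightarrow> H \<subseteq> L \<Longrightarrow> K \<subseteq> L \<Longrightarrow> H <#> K \<subseteq> L"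
  by (auto simp: set_mult_def intro: subgroup.m_closed)

section \<open>Closing a permutable subgroup under conjugation\<close>

lemma generate_subset_normalizing:
  assumes "L \<subseteq> carrier G" "T \<subseteq> normalizing L"
  shows "generate G T \<subseteq> normalizing L"
  using generate_subgroup_incl[OF assms(2) subgroup_normalizing[OF assms(1)]] .

text \<open>
  Elements of \<open>R\<close> can be moved past each generator of the join, hence past every word in them.
\<close>

lemma permute_join:
  assumes A: "subgroup A G" and B: "subgroup B G" and R: "subgroup R G"
    and AR: "A <#> R = R <#> A" and BR: "B <#> R = R <#> B"
  shows "generate G (A \<union> B) <#> R = R <#> generate G (A \<union> B)"
proof -
  have AB: "A \<union> B \<subseteq> carrier G" using A B subgroup.subset by blast
  define X where "X = generate G (A \<union> B)"
  have X: "subgroup X G" unfolding X_def using generate_is_subgroup[OF AB] .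
  have Rc: "R \<subseteq> carrier G" using R subgroup.subset by blast
  have Xc: "X \<subseteq> carrier G" using X subgroup.subset by blast
  have base: "r \<otimes> x \<in> X <#> R" if "x \<in> A \<union> B" "r \<in> R" for x r
  proof -
    have "r \<otimes> x \<in> A <#> R \<or> r \<otimes> x \<in> B <#> R"
      using that unfolding AR BR by (auto simp: set_mult_def)
    moreover have "A \<subseteq> X" "B \<subseteq> X" unfolding X_def using generate.incl[of _ "A \<union> B" G] by auto
    ultimately show ?thesis using mono_set_mult[of _ X R R G] by blast
  qed
  have "\<forall>r\<in>R. r \<otimes> x \<in> X <#> R" if "x \<in> generate G (A \<union> B)" for x
    using that
  proof (induction rule: generate.induct)
    case one
    show ?case using subset_product_right[OF X Rc] subgroup.mem_carrier[OF R] by auto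
  next
    case (incl h) then show ?case using base by blast
  next
    case (inv h)
    then have "inv h \<in> A \<union> B" using subgroup.m_inv_closed[OF A] subgroup.m_inv_closed[OF B] by auto
    then show ?case using base by blast
  next
    case (eng h1 h2)
    have c: "h1 \<in> carrier G" "h2 \<in> carrier G" using eng.hyps Xc unfolding X_def by auto
    show ?case
    proof
      fix r assume r: "r \<in> R"
      then obtain x r' where 1: "x \<in> X" "r' \<in> R" "r \<otimes> h1 = x \<otimes> r'"
        using eng.IH(1) by (auto simp: set_mult_def)
      then obtain x' r'' where 2: "x' \<in> X" "r'' \<in> R" "r' \<otimes> h2 = x' \<otimes> r''"
        using eng.IH(2) by (auto simp: set_mult_def)
      have c': "r \<in> carrier G" "r' \<in> carrier G" "r'' \<in> carrier G" "x \<in> carrier G" "x' \<in> carrier G"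
        using r 1 2 Rc Xc by auto
      have "r \<otimes> (h1 \<otimes> h2) = (r \<otimes> h1) \<otimes> h2" using c c' by (simp add: m_assoc)
      also have "\<dots> = x \<otimes> (r' \<otimes> h2)" using 1 c c' by (simp add: m_assoc)
      also have "\<dots> = (x \<otimes> x') \<otimes> r''" using 2 c' by (simp add: m_assoc)
      finally show "r \<otimes> (h1 \<otimes> h2) \<in> X <#> R"
        using subgroup.m_closed[OF X 1(1) 2(1)] 2(2) by (auto simp: set_mult_def)
    qed
  qed
  then have "R <#> X \<subseteq> X <#> R" unfolding X_def[symmetric] by (auto simp: set_mult_def)
  from permute_swap[OF X R subgroup_productI[OF X R this]] show ?thesis unfolding X_def .
qed

lemma conjugate_set_mult:
  assumes "g \<in> carrier G" "A \<subseteq> carrier G" "B \<subseteq> carrier G"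
  shows "conjugate g (A <#> B) = conjugate g A <#> conjugate g B"
proof -
  have e: "g \<otimes> (a \<otimes> b) \<otimes> inv g = (g \<otimes> a \<otimes> inv g) \<otimes> (g \<otimes> b \<otimes> inv g)" if "a \<in> A" "b \<in> B" for a b
    using conj_distrib[OF assms(1) subsetD[OF assms(2) that(1)] subsetD[OF assms(3) that(2)]] .
  have "conjugate g (A <#> B) = (\<lambda>(a, b). g \<otimes> (a \<otimes> b) \<otimes> inv g) ` (A \<times> B)"
    by (force simp: conjugate_def set_mult_def)
  also have "\<dots> = (\<lambda>(a, b). (g \<otimes> a \<otimes> inv g) \<otimes> (g \<otimes> b \<otimes> inv g)) ` (A \<times> B)"
    using e by (intro image_cong) auto
  also have "\<dots> = conjugate g A <#> conjugate g B"
    by (force simp: conjugate_def set_mult_def)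
  finally show ?thesis .
qed

lemma permute_conjugate:
  assumes "g \<in> carrier G" "subgroup A G" "subgroup R G"
    and "A <#> conjugate (inv g) R = conjugate (inv g) R <#> A"
  shows "conjugate g A <#> R = R <#> conjugate g A"
proof -
  have c: "A \<subseteq> carrier G" "R \<subseteq> carrier G" using assms subgroup.subset by blast+
  have c': "conjugate (inv g) R \<subseteq> carrier G" using conjugate_closed c assms by simp
  have "conjugate g (A <#> conjugate (inv g) R) = conjugate g (conjugate (inv g) R <#> A)" using assms(4) by simp
  then show ?thesis using conjugate_set_mult[OF assms(1) c(1) c'] conjugate_set_mult[OF assms(1) c' c(1)]
      conjugate_conjugate_inv(1)[OF assms(1) c(2)] by simp
qed

text \<open>
  The heart of the argument. If \<open>H\<close> permutes with \<open>P \<in> \<P>\<close> and \<open>b \<in> P\<close> does not normalize \<open>H\<close>, then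
  \<open>\<langle>H, bHb\<^sup>-\<^sup>1\<rangle>\<close> is a strictly larger subgroup that is still contained in \<open>HP\<close>. It therefore has the
  same \<open>q\<close>-part as \<open>H\<close> at every prime \<open>q\<close> outside \<open>S\<close>, and it permutes with all of \<open>\<R>\<close>, because
  \<open>\<R>\<close> is invariant under conjugation. Repeating this until nothing changes gives the least subgroup
  above \<open>H\<close> that is normalized by all members of \<open>\<P>\<close>.
\<close>

lemma closure_under_conjugation:
  assumes R: "\<And>P. P \<in> \<R> \<Longrightarrow> subgroup P G"
    and Rcj: "\<And>P g. P \<in> \<R> \<Longrightarrow> g \<in> carrier G \<Longrightarrow> conjugate g P \<in> \<R>"
    and PR: "\<P> \<subseteq> \<R>"
    and val0: "\<And>P q. P \<in> \<P> \<Longrightarrow> prime q \<Longrightarrow> q \<notin> S \<Longrightarrow> val q P = 0"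
    and H: "subgroup H G" and HR: "\<And>P. P \<in> \<R> \<Longrightarrow> H <#> P = P <#> H"
  obtains A where "subgroup A G" "H \<subseteq> A" "\<And>P. P \<in> \<R> \<Longrightarrow> A <#> P = P <#> A"
    "\<And>q. prime q \<Longrightarrow> q \<notin> S \<Longrightarrow> val q A = val q H"
    "\<Union>\<P> \<subseteq> normalizing A"
    "\<And>L. subgroup L G \<Longrightarrow> H \<subseteq> L \<Longrightarrow> \<Union>\<P> \<subseteq> normalizing L \<Longrightarrow> A \<subseteq> L"
proof -
  have "\<exists>A. subgroup A G \<and> H \<subseteq> A \<and> (\<forall>P\<in>\<R>. A <#> P = P <#> A) \<and>
     (\<forall>q. prime q \<longrightarrow> q \<notin> S \<longrightarrow> val q A = val q H) \<and> \<Union>\<P> \<subseteq> normalizing A \<and>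
     (\<forall>L. subgroup L G \<longrightarrow> H \<subseteq> L \<longrightarrow> \<Union>\<P> \<subseteq> normalizing L \<longrightarrow> A \<subseteq> L)"
    using H HR
  proof (induction "card (carrier G) - card H" arbitrary: H rule: less_induct)
    case less
    note H = less.prems(1) and HR = less.prems(2)
    show ?case
    proof (cases "\<Union>\<P> \<subseteq> normalizing H")
      case True
      then show ?thesis using H HR by (intro exI[of _ H]) auto
    next
      case False
      then obtain P b where b: "P \<in> \<P>" "b \<in> P" "b \<notin> normalizing H" by auto
      have PG: "P \<in> \<R>" using b PR by auto
      have P: "subgroup P G" using R PG by auto
      have bc: "b \<in> carrier G" using subgroup.mem_carrier[OF P b(2)] .
      have Hc: "H \<subseteq> carrier G" using H subgroup.subset by blast
      define K where "K = generate G (H \<union> conjugate b H)"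
      have HB: "H \<union> conjugate b H \<subseteq> carrier G" using Hc conjugate_closed[OF bc Hc] by auto
      have K: "subgroup K G" unfolding K_def using generate_is_subgroup[OF HB] .
      have HK: "H \<subseteq> K" "conjugate b H \<subseteq> K" unfolding K_def using generate.incl[of _ "H \<union> conjugate b H" G] by auto
      have HneK: "H \<noteq> K" using HK(2) b(3) bc by (auto simp: normalizing_iff)
      have ltc: "card H < card K" using HK(1) HneK finite_subgroup[OF K] by (simp add: psubset_card_mono psubset_eq)
      have leG: "card K \<le> card (carrier G)" using subgroup.subset[OF K] by (simp add: card_mono)
      have KR: "K <#> Q = Q <#> K" if Q: "Q \<in> \<R>" for Q
      proof -
        have "conjugate (inv b) Q \<in> \<R>" using Rcj[OF Q] bc by simp
        from permute_conjugate[OF bc H R[OF Q] HR[OF this]] have "conjugate b H <#> Q = Q <#> conjugate b H" .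
        from permute_join[OF H subgroup_conjugate[OF bc H] R[OF Q] HR[OF Q] this] show ?thesis
          unfolding K_def .
      qed
      have HPsub: "subgroup (H <#> P) G"
        using subgroup_productI[OF H P] HR[OF PG] by simp
      have "conjugate b H \<subseteq> H <#> P"
      proof
        fix x assume "x \<in> conjugate b H"
        then obtain h where h: "h \<in> H" "x = b \<otimes> h \<otimes> inv b" by (auto simp: conjugate_def)
        have "h \<in> H <#> P" using subset_product_left[OF P Hc] h by blast
        moreover have "b \<in> H <#> P" using subset_product_right[OF H subgroup.subset[OF P]] b by blast
        ultimately show "x \<in> H <#> P" unfolding h(2)
          by (intro subgroup.m_closed[OF HPsub] subgroup.m_inv_closed[OF HPsub])
      qed
      then have KHP: "K \<subseteq> H <#> P" unfolding K_def
        using generate_subgroup_incl[OF _ HPsub] subset_product_left[OF P Hc] by simp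
      \<comment> \<open>\<open>K\<close> lies between \<open>H\<close> and \<open>HP\<close>, and \<open>P\<close> contributes nothing at primes outside \<open>S\<close>.\<close>
      have valK: "val q K = val q H" if q: "prime q" "q \<notin> S" for q
        using val_mono[OF K HPsub KHP, of q] val_product_le[OF H P q(1)] val0[OF b(1) q]
          val_mono[OF H K HK(1), of q] by simp
      obtain A where A: "subgroup A G" "K \<subseteq> A" "\<forall>P\<in>\<R>. A <#> P = P <#> A"
        "\<forall>q. prime q \<longrightarrow> q \<notin> S \<longrightarrow> val q A = val q K" "\<Union>\<P> \<subseteq> normalizing A"
        "\<forall>L. subgroup L G \<longrightarrow> K \<subseteq> L \<longrightarrow> \<Union>\<P> \<subseteq> normalizing L \<longrightarrow> A \<subseteq> L"
        using less.hyps[OF diff_less_mono2[OF ltc order_less_le_trans[OF ltc leG]] K KR] by blast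
      have "A \<subseteq> L" if L: "subgroup L G" "H \<subseteq> L" "\<Union>\<P> \<subseteq> normalizing L" for L
      proof -
        have "b \<in> normalizing L" using b L by auto
        then have "conjugate b H \<subseteq> L" using conjugate_mono[OF L(2), of b] by (auto simp: normalizing_iff)
        then have "K \<subseteq> L" unfolding K_def using generate_subgroup_incl[OF _ L(1)] L(2) by simp
        then show ?thesis using A(6) L by blast
      qed
      then show ?thesis using A HK(1) valK by (intro exI[of _ A]) auto
    qed
  qed
  then obtain A where A: "subgroup A G" "H \<subseteq> A" "\<forall>P\<in>\<R>. A <#> P = P <#> A"
    "\<forall>q. prime q \<longrightarrow> q \<notin> S \<longrightarrow> val q A = val q H" "\<Union>\<P> \<subseteq> normalizing A"
    "\<forall>L. subgroup L G \<longrightarrow> H \<subseteq> L \<longrightarrow> \<Union>\<P> \<subseteq> normalizing L \<longrightarrow> A \<subseteq> L"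
    by (elim exE conjE)
  show ?thesis
  proof (rule that[OF A(1,2) _ _ A(5)])
    show "A <#> P = P <#> A" if "P \<in> \<R>" for P using A(3) that by (rule bspec)
    show "val q A = val q H" if "prime q" "q \<notin> S" for q using A(4) that by simp
    show "A \<subseteq> L" if "subgroup L G" "H \<subseteq> L" "\<Union>\<P> \<subseteq> normalizing L" for L
      using A(6) that by simp
  qed
qed

section \<open>Elements of prime power order\<close>

text \<open>
  Since \<open>x\<close> normalizes \<open>A\<close>, the product \<open>A\<langle>x\<rangle>\<close> is a subgroup, and it can exceed \<open>A\<close> only at the
  prime \<open>q\<close>, where \<open>A\<close> is already as large as \<open>M\<close>.
\<close>

lemma q_element_in_coprime_index_subgroup:
  assumes A: "subgroup A G" and M: "subgroup M G" and AM: "A \<subseteq> M"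
    and x: "x \<in> M" "q_element q x" "prime q" "x \<in> normalizing A" and v: "val q M = val q A"
  shows "x \<in> A"
proof -
  have xc: "x \<in> carrier G" using x(2) by (simp add: q_element_def)
  have X: "subgroup (generate G {x}) G" using generate_is_subgroup xc by simp
  have "generate G {x} \<subseteq> normalizing A"
    using generate_subset_normalizing[OF subgroup.subset[OF A]] x(4) by simp
  from subgroup_product_normalizing[OF A X this] have AX: "subgroup (A <#> generate G {x}) G" .
  have "generate G {x} \<subseteq> M" using generate_subgroup_incl[OF _ M] x(1) by simp
  with product_subset_subgroup[OF M AM] have AXM: "A <#> generate G {x} \<subseteq> M" .
  have "A = A <#> generate G {x}"
  proof (rule subgroup_eqI_val[OF A AX])
    show "A \<subseteq> A <#> generate G {x}" using subset_product_left[OF X subgroup.subset[OF A]] .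
    fix p :: nat assume p: "prime p"
    show "val p (A <#> generate G {x}) \<le> val p A"
    proof (cases "p = q")
      case True then show ?thesis using val_mono[OF AX M AXM, of q] v by simp
    next
      case False then show ?thesis
        using val_product_le[OF A X p] val_cyclic_q_element[OF x(2) x(3) p] by simp
    qed
  qed
  moreover have "x \<in> A <#> generate G {x}"
    using subset_product_right[OF A subgroup.subset[OF X]] generate.incl[of x "{x}" G] by auto
  ultimately show ?thesis by simp
qed

lemma q_element_conjugate:
  assumes "g \<in> carrier G" "q_element q x"
  shows "q_element q (g \<otimes> x \<otimes> inv g)"
proof -
  obtain a where a: "x \<in> carrier G" "x [^] (q ^ a :: nat) = \<one>" using assms q_element_def by auto
  have "(g \<otimes> x \<otimes> inv g) [^] n = g \<otimes> x [^] n \<otimes> inv g" for n :: nat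
  proof (induction n)
    case 0 then show ?case using assms a by simp
  next
    case (Suc n)
    then show ?case using assms(1) a(1) conj_distrib[of g "x [^] n" x] by simp
  qed
  then show ?thesis using a assms(1) unfolding q_element_def by (intro conjI exI[of _ a]) auto
qed

text \<open>
  For \<open>S = - \<pi>\<close> and a subgroup \<open>M\<close> this is \<open>O\<^sup>\<pi>(M)\<close>, the smallest normal subgroup of \<open>M\<close> whose
  quotient is a \<open>\<pi>\<close>-group.
\<close>

definition pi_part :: "nat set \<Rightarrow> 'a set \<Rightarrow> 'a set" where
  "pi_part S M = generate G {x \<in> M. \<exists>q\<in>S. prime q \<and> q_element q x}"

lemma pi_part_subset: "subgroup M G \<Longrightarrow> pi_part S M \<subseteq> M"
  unfolding pi_part_def by (rule generate_subgroup_incl) auto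

lemma subgroup_pi_part: "M \<subseteq> carrier G \<Longrightarrow> subgroup (pi_part S M) G"
  unfolding pi_part_def by (rule generate_is_subgroup) auto

lemma pi_part_normal:
  assumes "M \<lhd> G" shows "pi_part S M \<lhd> G"
  unfolding pi_part_def
proof (rule normal_generateI)
  have M: "subgroup M G" "carrier G \<subseteq> normalizing M" using assms normal_iff_normalizing by auto
  show "{x \<in> M. \<exists>q\<in>S. prime q \<and> q_element q x} \<subseteq> carrier G" using subgroup.subset[OF M(1)] by auto
  fix h g assume h: "h \<in> {x \<in> M. \<exists>q\<in>S. prime q \<and> q_element q x}" and g: "g \<in> carrier G"
  have "g \<otimes> h \<otimes> inv g \<in> M" using normalizingD[OF subsetD[OF M(2) g]] h by simp
  then show "g \<otimes> h \<otimes> inv g \<in> {x \<in> M. \<exists>q\<in>S. prime q \<and> q_element q x}"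
    using h q_element_conjugate[OF g] by blast
qed

lemma val_pi_part:
  assumes "subgroup M G" "q \<in> S" "prime q"
  shows "val q (pi_part S M) = val q M"
proof (rule val_eqI_q_elements[OF subgroup_pi_part[OF subgroup.subset[OF assms(1)]] assms(1) pi_part_subset[OF assms(1)] assms(3)])
  fix y assume "y \<in> M" "q_element q y"
  then show "y \<in> pi_part S M" unfolding pi_part_def using assms by (intro generate.incl) auto
qed

section \<open>Permuting with a projector\<close>

lemma normalizing_conjugate:
  assumes g: "g \<in> carrier G" and M: "M \<subseteq> carrier G" and x: "x \<in> carrier G" "inv g \<otimes> x \<otimes> g \<in> normalizing M"
  shows "x \<in> normalizing (conjugate g M)"
proof -
  define y where "y = inv g \<otimes> x \<otimes> g"
  have yc: "y \<in> carrier G" using g x by (simp add: y_def)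
  have "g \<otimes> y = x \<otimes> g" using g x by (simp add: y_def m_assoc[symmetric])
  then have "conjugate x (conjugate g M) = conjugate g (conjugate y M)" using conjugate_conjugate g x M yc by simp
  also have "\<dots> = conjugate g M" using normalizing_conjugate_eq[of y M] x M unfolding y_def by simp
  finally show ?thesis using x by (simp add: normalizing_iff)
qed

text \<open>
  For \<open>g\<close> in a member of \<open>\<P>\<close>, conjugation by \<open>g\<close> fixes \<open>A\<close> and permutes \<open>\<Q>\<close>, so by minimality it
  fixes the closure \<open>M\<close> of \<open>A\<close> under \<open>\<Q>\<close>. Thus \<open>M\<close> is normalized by all elements of prime power order,
  and these generate \<open>G\<close>.
\<close>

lemma closure_of_normalized_is_normal:
  assumes A: "subgroup A G" and M: "subgroup M G" and AM: "A \<subseteq> M"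
    and PA: "\<Union>\<P> \<subseteq> normalizing A" and QM: "\<Union>\<Q> \<subseteq> normalizing M"
    and minM: "\<And>L. subgroup L G \<Longrightarrow> A \<subseteq> L \<Longrightarrow> \<Union>\<Q> \<subseteq> normalizing L \<Longrightarrow> M \<subseteq> L"
    and Qcj: "\<And>Q g. Q \<in> \<Q> \<Longrightarrow> g \<in> carrier G \<Longrightarrow> conjugate g Q \<in> \<Q>"
    and gen: "\<And>q x. prime q \<Longrightarrow> q_element q x \<Longrightarrow> x \<in> generate G (\<Union>\<P>) \<or> x \<in> generate G (\<Union>\<Q>)"
  shows "M \<lhd> G"
proof -
  have Mc: "M \<subseteq> carrier G" and Ac: "A \<subseteq> carrier G" using A M subgroup.subset by blast+
  have PM: "\<Union>\<P> \<subseteq> normalizing M"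
  proof
    fix g assume "g \<in> \<Union>\<P>"
    then have g: "g \<in> normalizing A" using PA by blast
    have gc: "g \<in> carrier G" using g normalizing_subset by blast
    have "M \<subseteq> conjugate g M"
    proof (rule minM[OF subgroup_conjugate[OF gc M]])
      show "A \<subseteq> conjugate g M" using conjugate_mono[OF AM, of g] normalizing_conjugate_eq[OF g Ac] by simp
      show "\<Union>\<Q> \<subseteq> normalizing (conjugate g M)"
      proof
        fix x assume "x \<in> \<Union>\<Q>"
        then obtain Q where Q: "Q \<in> \<Q>" "x \<in> Q" by blast
        have "x \<in> normalizing M" using QM Q by blast
        then have xc: "x \<in> carrier G" using normalizing_subset by blast
        have "inv g \<otimes> x \<otimes> g \<in> conjugate (inv g) Q" using Q gc by (auto simp: conjugate_def)
        then have "inv g \<otimes> x \<otimes> g \<in> normalizing M" using Qcj[OF Q(1), of "inv g"] gc QM by blast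
        then show "x \<in> normalizing (conjugate g M)" by (rule normalizing_conjugate[OF gc Mc xc])
      qed
    qed
    then have "M = conjugate g M"
      using card_conjugate[OF gc Mc] card_subset_eq[OF finite_subgroup[OF subgroup_conjugate[OF gc M]]] by simp
    then show "g \<in> normalizing M" using gc by (simp add: normalizing_iff)
  qed
  have N: "subgroup (normalizing M) G" using subgroup_normalizing[OF Mc] .
  have el: "y \<in> normalizing M" if "q_element q y" "prime q" for q y
    using gen[OF that(2,1)] generate_subset_normalizing[OF Mc PM] generate_subset_normalizing[OF Mc QM]
    by blast
  have "normalizing M = carrier G"
  proof (rule subgroup_eqI_val[OF N subgroup_self normalizing_subset])
    fix q :: nat assume q: "prime q"
    show "val q (carrier G) \<le> val q (normalizing M)"
      using val_eqI_q_elements[OF N subgroup_self normalizing_subset q] el q by simp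
  qed
  then show ?thesis using M by (simp add: normal_iff_normalizing)
qed

text \<open>
  Here \<open>\<P>\<close> stands for the conjugates of the given projector for the block \<open>S\<close>, \<open>\<Q>\<close> for those of the
  projectors for the other blocks, and \<open>E\<close> for an arbitrary projector for \<open>S\<close>. The closures \<open>A\<close> and \<open>B\<close> of
  \<open>H\<close> under \<open>\<P>\<close> and \<open>\<Q>\<close> grow only at primes in \<open>S\<close> and only at primes outside \<open>S\<close>, respectively, whence
  \<open>A \<inter> B = H\<close>. Modulo the normal subgroup \<open>D \<subseteq> H\<close> below, the normal closure of \<open>H\<close> is the direct
  product of the \<open>S\<close>-group \<open>U/D\<close> and a group \<open>V/D\<close> of order prime to \<open>S\<close>; \<open>E\<close> absorbs the first factor
  by maximality and normalizes the trace \<open>W\<close> of \<open>H\<close> on the second.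
\<close>

theorem permutes_with_projector:
  assumes P: "\<And>P. P \<in> \<P> \<Longrightarrow> subgroup P G" and Q: "\<And>P. P \<in> \<Q> \<Longrightarrow> subgroup P G"
    and Pcj: "\<And>P g. P \<in> \<P> \<Longrightarrow> g \<in> carrier G \<Longrightarrow> conjugate g P \<in> \<P>"
    and Qcj: "\<And>P g. P \<in> \<Q> \<Longrightarrow> g \<in> carrier G \<Longrightarrow> conjugate g P \<in> \<Q>"
    and valP: "\<And>P q. P \<in> \<P> \<Longrightarrow> prime q \<Longrightarrow> q \<notin> S \<Longrightarrow> val q P = 0"
    and valQ: "\<And>P q. P \<in> \<Q> \<Longrightarrow> prime q \<Longrightarrow> q \<in> S \<Longrightarrow> val q P = 0"
    and genP: "\<And>q x. prime q \<Longrightarrow> q \<in> S \<Longrightarrow> q_element q x \<Longrightarrow> x \<in> generate G (\<Union>\<P>)"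
    and genQ: "\<And>q x. prime q \<Longrightarrow> q \<notin> S \<Longrightarrow> q_element q x \<Longrightarrow> x \<in> generate G (\<Union>\<Q>)"
    and H: "subgroup H G" and HP: "\<And>P. P \<in> \<P> \<union> \<Q> \<Longrightarrow> H <#> P = P <#> H"
    and E: "subgroup E G" and valE: "\<And>q. prime q \<Longrightarrow> q \<notin> S \<Longrightarrow> val q E = 0"
    and EP: "E \<subseteq> generate G (\<Union>\<P>)"
    and maxE: "\<And>D X. D \<lhd> G \<Longrightarrow> subgroup X G \<Longrightarrow> E <#> D \<subseteq> X \<Longrightarrow>
       (\<And>q. prime q \<Longrightarrow> q \<notin> S \<Longrightarrow> val q X = val q D) \<Longrightarrow> X \<subseteq> E <#> D"
  shows "subgroup (H <#> E) G"
proof -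
  let ?R = "\<P> \<union> \<Q>"
  have R: "\<And>P. P \<in> ?R \<Longrightarrow> subgroup P G" using P Q by blast
  have Rcj: "\<And>P g. P \<in> ?R \<Longrightarrow> g \<in> carrier G \<Longrightarrow> conjugate g P \<in> ?R" using Pcj Qcj by blast
  have valQ': "\<And>P q. P \<in> \<Q> \<Longrightarrow> prime q \<Longrightarrow> q \<notin> - S \<Longrightarrow> val q P = 0" using valQ by simp
  obtain A where A: "subgroup A G" "H \<subseteq> A" "\<And>P. P \<in> ?R \<Longrightarrow> A <#> P = P <#> A"
    "\<And>q. prime q \<Longrightarrow> q \<notin> S \<Longrightarrow> val q A = val q H" "\<Union>\<P> \<subseteq> normalizing A"
    "\<And>L. subgroup L G \<Longrightarrow> H \<subseteq> L \<Longrightarrow> \<Union>\<P> \<subseteq> normalizing L \<Longrightarrow> A \<subseteq> L"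
    by (rule closure_under_conjugation[of ?R \<P> S H, OF R Rcj _ valP H HP]) (assumption | blast)+
  obtain B where B: "subgroup B G" "H \<subseteq> B" "\<And>P. P \<in> ?R \<Longrightarrow> B <#> P = P <#> B"
    "\<And>q. prime q \<Longrightarrow> q \<notin> - S \<Longrightarrow> val q B = val q H" "\<Union>\<Q> \<subseteq> normalizing B"
    "\<And>L. subgroup L G \<Longrightarrow> H \<subseteq> L \<Longrightarrow> \<Union>\<Q> \<subseteq> normalizing L \<Longrightarrow> B \<subseteq> L"
    by (rule closure_under_conjugation[of ?R \<Q> "- S" H, OF R Rcj _ valQ' H HP]) (assumption | blast)+
  obtain M where M: "subgroup M G" "A \<subseteq> M"
    "\<And>q. prime q \<Longrightarrow> q \<notin> - S \<Longrightarrow> val q M = val q A" "\<Union>\<Q> \<subseteq> normalizing M"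
    "\<And>L. subgroup L G \<Longrightarrow> A \<subseteq> L \<Longrightarrow> \<Union>\<Q> \<subseteq> normalizing L \<Longrightarrow> M \<subseteq> L"
    by (rule closure_under_conjugation[of ?R \<Q> "- S" A, OF R Rcj _ valQ' A(1) A(3)]) (assumption | blast)+
  obtain M' where M': "subgroup M' G" "B \<subseteq> M'"
    "\<And>q. prime q \<Longrightarrow> q \<notin> S \<Longrightarrow> val q M' = val q B" "\<Union>\<P> \<subseteq> normalizing M'"
    "\<And>L. subgroup L G \<Longrightarrow> B \<subseteq> L \<Longrightarrow> \<Union>\<P> \<subseteq> normalizing L \<Longrightarrow> M' \<subseteq> L"
    by (rule closure_under_conjugation[of ?R \<P> S B, OF R Rcj _ valP B(1) B(3)]) (assumption | blast)+
  have Mn: "M \<lhd> G"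
    by (rule closure_of_normalized_is_normal[OF A(1) M(1,2) A(5) M(4) M(5) Qcj]) (use genP genQ in blast)+
  have Mn': "M' \<lhd> G"
    by (rule closure_of_normalized_is_normal[OF B(1) M'(1,2) B(5) M'(4) M'(5) Pcj]) (use genP genQ in blast)+
  have Pc: "\<Union>\<P> \<subseteq> carrier G" and Qc: "\<Union>\<Q> \<subseteq> carrier G"
    using P[THEN subgroup.subset] Q[THEN subgroup.subset] by blast+
  have normM: "carrier G \<subseteq> normalizing M" "carrier G \<subseteq> normalizing M'"
    using Mn Mn' normal_iff_normalizing by auto
  \<comment> \<open>Both \<open>M\<close> and \<open>M'\<close> are the normal closure of \<open>H\<close>.\<close>
  have "A \<subseteq> M'" by (rule A(6)[OF M'(1)]) (use B(2) M'(2) Pc normM in auto)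
  then have "M \<subseteq> M'" by (rule M(5)[OF M'(1)]) (use Qc normM in auto)
  moreover have "B \<subseteq> M" by (rule B(6)[OF M(1)]) (use A(2) M(2) Qc normM in auto)
  then have "M' \<subseteq> M" by (rule M'(5)[OF M(1)]) (use Pc normM in auto)
  ultimately have MM: "M' = M" by simp
  have valMB: "\<And>q. prime q \<Longrightarrow> q \<notin> S \<Longrightarrow> val q M = val q B" using M'(3) MM by simp
  have BM: "B \<subseteq> M" using M'(2) MM by simp
  have HM: "H \<subseteq> M" using A(2) M(2) by simp
  define U where "U = pi_part S M"
  define V where "V = pi_part (- S) M"
  define D where "D = U \<inter> V"
  define W where "W = H \<inter> V"
  have Un: "U \<lhd> G" and Vn: "V \<lhd> G" unfolding U_def V_def using pi_part_normal[OF Mn] by auto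
  then have U: "subgroup U G" and V: "subgroup V G" by (auto intro: normal_imp_subgroup)
  have UM: "U \<subseteq> M" and VM: "V \<subseteq> M" unfolding U_def V_def using pi_part_subset[OF M(1)] by auto
  have Dn: "D \<lhd> G" unfolding D_def by (rule normal_subgroup_intersect[OF Un Vn])
  then have D: "subgroup D G" by (rule normal_imp_subgroup)
  have normU: "carrier G \<subseteq> normalizing U" and normV: "carrier G \<subseteq> normalizing V"
    and normD: "carrier G \<subseteq> normalizing D" using Un Vn Dn normal_iff_normalizing by auto
  have valU: "\<And>q. prime q \<Longrightarrow> q \<in> S \<Longrightarrow> val q U = val q M"
    unfolding U_def using val_pi_part[OF M(1)] by blast
  have valV: "\<And>q. prime q \<Longrightarrow> q \<notin> S \<Longrightarrow> val q V = val q M"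
    unfolding V_def using val_pi_part[OF M(1), of _ "- S"] by simp
  have UA: "U \<subseteq> A" unfolding U_def pi_part_def
  proof (rule generate_subgroup_incl[OF _ A(1)], rule subsetI)
    fix x assume "x \<in> {x \<in> M. \<exists>q\<in>S. prime q \<and> q_element q x}"
    then obtain q where x: "x \<in> M" "q \<in> S" "prime q" "q_element q x" by blast
    have "x \<in> normalizing A"
      using genP[OF x(3,2,4)] generate_subset_normalizing[OF subgroup.subset[OF A(1)] A(5)] by blast
    then show "x \<in> A"
      using q_element_in_coprime_index_subgroup[OF A(1) M(1,2) x(1,4,3)] M(3)[OF x(3)] x(2) by simp
  qed
  have VB: "V \<subseteq> B" unfolding V_def pi_part_def
  proof (rule generate_subgroup_incl[OF _ B(1)], rule subsetI)
    fix x assume "x \<in> {x \<in> M. \<exists>q\<in>- S. prime q \<and> q_element q x}"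
    then obtain q where x: "x \<in> M" "q \<notin> S" "prime q" "q_element q x" by blast
    have "x \<in> normalizing B"
      using genQ[OF x(3,2,4)] generate_subset_normalizing[OF subgroup.subset[OF B(1)] B(5)] by blast
    then show "x \<in> B"
      using q_element_in_coprime_index_subgroup[OF B(1) M(1) BM x(1,4,3)] valMB[OF x(3,2)] by simp
  qed
  have AB: "A \<inter> B = H"
  proof (rule subgroup_eqI_val[OF H subgroup_inter[OF A(1) B(1)], symmetric])
    show "H \<subseteq> A \<inter> B" using A(2) B(2) by simp
    fix q :: nat assume q: "prime q"
    show "val q (A \<inter> B) \<le> val q H"
      using val_mono[OF subgroup_inter[OF A(1) B(1)] A(1), of q]
        val_mono[OF subgroup_inter[OF A(1) B(1)] B(1), of q] A(4)[OF q] B(4)[OF q]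
      by (cases "q \<in> S") auto
  qed
  have DW: "D \<subseteq> W" unfolding D_def W_def using UA VB AB by blast
  have W: "subgroup W G" unfolding W_def by (rule subgroup_inter[OF H V])
  \<comment> \<open>Written this way, \<open>W\<close> is visibly normalized by \<open>E\<close>.\<close>
  have WAV: "W = A \<inter> V" unfolding W_def using VB AB by blast
  have EA: "E \<subseteq> normalizing A"
    using EP generate_subset_normalizing[OF subgroup.subset[OF A(1)] A(5)] by blast
  have Ec: "E \<subseteq> carrier G" using subgroup.subset[OF E] .
  have EW: "E \<subseteq> normalizing W"
  proof
    fix g assume g: "g \<in> E"
    have "g \<otimes> w \<otimes> inv g \<in> W" if "w \<in> W" for w
      using normalizingD[OF subsetD[OF EA g], of w] normalizingD[OF subsetD[OF normV], of g w] Ec g that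
      unfolding WAV by blast
    then show "g \<in> normalizing W" using g Ec by (auto simp: normalizing_def)
  qed
  have WE: "subgroup (W <#> E) G" by (rule subgroup_product_normalizing[OF W E EW])
  have sub: "subgroup (X <#> Y) G" if "carrier G \<subseteq> normalizing X" "subgroup X G" "subgroup Y G" for X Y
    by (rule subgroup_product_normalizing[OF that(2,3)]) (use subgroup.subset[OF that(3)] that(1) in blast)
  have ED: "E <#> D = D <#> E"
    by (rule permute_swap[OF D E sub[OF normD D E], symmetric])
  have UE: "subgroup (U <#> E) G" by (rule sub[OF normU U E])
  \<comment> \<open>Outside \<open>S\<close> the orders of \<open>U\<close> and \<open>D\<close> agree, so \<open>UE/D\<close> is an \<open>S\<close>-group containing \<open>ED/D\<close>.\<close>
  have UsubED: "U \<subseteq> E <#> D"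
  proof -
    have "U <#> E \<subseteq> E <#> D"
    proof (rule maxE[OF Dn UE])
      show "E <#> D \<subseteq> U <#> E" unfolding ED by (rule mono_set_mult) (auto simp: D_def)
      fix q :: nat assume q: "prime q" "q \<notin> S"
      have UV: "subgroup (U <#> V) G" by (rule sub[OF normU U V])
      have "val q (U <#> V) \<le> val q M"
        by (rule val_mono[OF UV M(1) product_subset_subgroup[OF M(1) UM VM]])
      then have "val q U \<le> val q D"
        using val_product[OF U V q(1)] valV[OF q] unfolding D_def by simp
      then have "val q (U <#> E) \<le> val q D"
        using val_product_le[OF U E q(1)] valE[OF q] by simp
      moreover have "D \<subseteq> U <#> E"
        using subset_product_left[OF E subgroup.subset[OF U]] by (auto simp: D_def)
      ultimately show "val q (U <#> E) = val q D" using val_mono[OF D UE] by (simp add: antisym)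
    qed
    then show ?thesis using subset_product_left[OF E subgroup.subset[OF U]] by blast
  qed
  have HX: "val q (H \<inter> X) = val q H"
    if X: "subgroup X G" "X \<subseteq> M" "carrier G \<subseteq> normalizing X" "val q X = val q M" "prime q" for q X
  proof -
    have XH: "subgroup (X <#> H) G" by (rule sub[OF X(3,1) H])
    have "val q (X <#> H) \<le> val q M"
      by (rule val_mono[OF XH M(1) product_subset_subgroup[OF M(1) X(2) HM]])
    moreover have "val q (X \<inter> H) \<le> val q H" by (rule val_mono[OF subgroup_inter[OF X(1) H] H]) simp
    ultimately show ?thesis using val_product[OF X(1) H X(5)] X(4) by (simp add: Int_commute)
  qed
  have HU: "subgroup (H \<inter> U) G" by (rule subgroup_inter[OF H U])
  have norm': "H \<inter> U \<subseteq> normalizing W"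
  proof
    fix g assume g: "g \<in> H \<inter> U"
    have "g \<in> carrier G" "g \<in> normalizing H" using g subgroup.subset[OF H] subgroup_subset_normalizing[OF H] by auto
    then show "g \<in> normalizing W"
      using normV by (auto simp: normalizing_def W_def)
  qed
  have WU: "subgroup (W <#> (H \<inter> U)) G" by (rule subgroup_product_normalizing[OF W HU norm'])
  \<comment> \<open>\<open>H \<inter> U\<close> carries the full order of \<open>H\<close> at primes in \<open>S\<close>, and \<open>W = H \<inter> V\<close> at the others.\<close>
  have "W <#> (H \<inter> U) = H"
  proof (rule subgroup_eqI_val[OF WU H])
    show "W <#> (H \<inter> U) \<subseteq> H" by (rule product_subset_subgroup[OF H]) (auto simp: W_def)
    fix q :: nat assume q: "prime q"
    show "val q H \<le> val q (W <#> (H \<inter> U))"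
    proof (cases "q \<in> S")
      case True
      have "val q (H \<inter> U) \<le> val q (W <#> (H \<inter> U))"
        by (rule val_mono[OF HU WU subset_product_right[OF W subgroup.subset[OF HU]]])
      then show ?thesis using HX[OF U UM normU valU[OF q True] q] by simp
    next
      case False
      have "val q W \<le> val q (W <#> (H \<inter> U))"
        by (rule val_mono[OF W WU subset_product_left[OF HU subgroup.subset[OF W]]])
      then show ?thesis using HX[OF V VM normV valV[OF q False] q] unfolding W_def by simp
    qed
  qed
  moreover have "W <#> (H \<inter> U) \<subseteq> W <#> E"
  proof (rule product_subset_subgroup[OF WE])
    show Ws: "W \<subseteq> W <#> E" by (rule subset_product_left[OF E subgroup.subset[OF W]])
    have "E \<subseteq> W <#> E" by (rule subset_product_right[OF W Ec])
    with Ws DW have "E <#> D \<subseteq> W <#> E" by (intro product_subset_subgroup[OF WE]) auto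
    then show "H \<inter> U \<subseteq> W <#> E" using UsubED by blast
  qed
  ultimately have "H \<subseteq> W <#> E" by simp
  then have "H <#> E \<subseteq> W <#> E"
    by (rule product_subset_subgroup[OF WE _ subset_product_right[OF W Ec]])
  moreover have "W <#> E \<subseteq> H <#> E" by (rule mono_set_mult) (auto simp: W_def)
  ultimately have "H <#> E = W <#> E" by simp
  then show ?thesis using WE by simp
qed

section \<open>Maximal subgroups of quotients and projectors\<close>

text \<open>
  For \<open>N\<close> normal in \<open>X\<close> this says that \<open>E/N\<close> is a maximal \<open>\<pi>\<close>-subgroup of \<open>X/N\<close>. Stated in terms of
  subgroups of \<open>G\<close> and their orders, it allows passing between sections of \<open>G\<close> while
  staying in one type.
\<close>

definition pi_max_over :: "nat set \<Rightarrow> 'a set \<Rightarrow> 'a set \<Rightarrow> 'a set \<Rightarrow> bool" where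
  "pi_max_over \<pi> X N E \<longleftrightarrow> subgroup E G \<and> N \<subseteq> E \<and> E \<subseteq> X \<and>
     (\<forall>q. prime q \<longrightarrow> q \<notin> \<pi> \<longrightarrow> val q E = val q N) \<and>
     (\<forall>Y. subgroup Y G \<longrightarrow> E \<subseteq> Y \<longrightarrow> Y \<subseteq> X \<longrightarrow>
        (\<forall>q. prime q \<longrightarrow> q \<notin> \<pi> \<longrightarrow> val q Y = val q N) \<longrightarrow> Y = E)"

lemma pi_max_over_maximal:
  assumes "pi_max_over \<pi> X N E" "subgroup Y G" "E \<subseteq> Y" "Y \<subseteq> X"
    and "\<And>q. prime q \<Longrightarrow> q \<notin> \<pi> \<Longrightarrow> val q Y = val q N"
  shows "Y = E"
  using assms unfolding pi_max_over_def by simp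

lemma card_rcosets_in:
  assumes X: "subgroup X G" and N: "subgroup N G" and NX: "N \<subseteq> X"
  shows "card (rcosets\<^bsub>G\<lparr>carrier := X\<rparr>\<^esub> N) * card N = card X"
proof -
  interpret X: group "G\<lparr>carrier := X\<rparr>" using X by (rule subgroup_imp_group)
  from X.lagrange[of N] subgroup_of_subgroup_iff[OF X] N NX show ?thesis
    by (simp add: order_def)
qed

lemma Union_rcosets_in:
  assumes X: "subgroup X G" and N: "subgroup N G" and NX: "N \<subseteq> X"
  shows "\<Union>(rcosets\<^bsub>G\<lparr>carrier := X\<rparr>\<^esub> N) = X"
proof -
  interpret X: group "G\<lparr>carrier := X\<rparr>" using X by (rule subgroup_imp_group)
  from X.rcosets_part_G[of N] subgroup_of_subgroup_iff[OF X] N NX show ?thesis by simp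
qed

lemma rcosets_in_mono:
  "X \<subseteq> Y \<Longrightarrow> rcosets\<^bsub>G\<lparr>carrier := X\<rparr>\<^esub> N \<subseteq> rcosets\<^bsub>G\<lparr>carrier := Y\<rparr>\<^esub> N"
  by (auto simp: RCOSETS_def)

lemma pi_subgroup_factor_iff:
  assumes N: "N \<lhd> G" and X: "subgroup X G" and NX: "N \<subseteq> X"
  shows "pi_subgroup \<pi> (G Mod N) (rcosets\<^bsub>G\<lparr>carrier := X\<rparr>\<^esub> N) \<longleftrightarrow>
    (\<forall>q. prime q \<longrightarrow> q \<notin> \<pi> \<longrightarrow> val q X = val q N)"
proof -
  let ?R = "rcosets\<^bsub>G\<lparr>carrier := X\<rparr>\<^esub> N"
  have Ns: "subgroup N G" using N by (rule normal_imp_subgroup)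
  have R: "subgroup ?R (G Mod N)" by (rule normal_subgroup_factorize[OF N NX X])
  have GN: "group (G Mod N)" by (rule normal.factorgroup_is_group[OF N])
  have Rg: "group ((G Mod N)\<lparr>carrier := ?R\<rparr>)" using group.subgroup_imp_group[OF GN R] .
  have c: "card ?R * card N = card X" by (rule card_rcosets_in[OF X Ns NX])
  have pos: "card N > 0" "card X > 0" using card_subgroup_pos Ns X by auto
  then have Rpos: "card ?R > 0" using c by (metis mult_eq_0_iff neq0_conv)
  have "val q X = val q ?R + val q N" if "prime q" for q
    using prime_elem_multiplicity_mult_distrib[of q "card ?R" "card N"] that pos Rpos c by simp
  then show ?thesis
    using R Rg multiplicity_eq_0_iff_prime_factors[OF Rpos, of \<pi>] Rpos
    by (auto simp: pi_subgroup_def pi_group_def order_def intro: card_ge_0_finite)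
qed

lemma pi_maximal_factor_iff:
  assumes N: "N \<lhd> G" and E: "subgroup E G" and NE: "N \<subseteq> E"
  shows "pi_maximal \<pi> (G Mod N) (rcosets\<^bsub>G\<lparr>carrier := E\<rparr>\<^esub> N) \<longleftrightarrow> pi_max_over \<pi> (carrier G) N E"
    (is "?L \<longleftrightarrow> ?R")
proof
  have Ns: "subgroup N G" using N by (rule normal_imp_subgroup)
  assume L: ?L
  show ?R unfolding pi_max_over_def
  proof (intro conjI allI impI)
    show "subgroup E G" "N \<subseteq> E" "E \<subseteq> carrier G" using E NE subgroup.subset by auto
    show "val q E = val q N" if "prime q" "q \<notin> \<pi>" for q
      using L that pi_subgroup_factor_iff[OF N E NE] by (auto simp: pi_maximal_def)
    fix Y assume Y: "subgroup Y G" "E \<subseteq> Y" "\<forall>q. prime q \<longrightarrow> q \<notin> \<pi> \<longrightarrow> val q Y = val q N"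
    have NY: "N \<subseteq> Y" using NE Y by auto
    have "rcosets\<^bsub>G\<lparr>carrier := E\<rparr>\<^esub> N = rcosets\<^bsub>G\<lparr>carrier := Y\<rparr>\<^esub> N"
      using L pi_subgroup_factor_iff[OF N Y(1) NY, of \<pi>] Y(3) rcosets_in_mono[OF Y(2), of N]
      unfolding pi_maximal_def by blast
    then have "\<Union>(rcosets\<^bsub>G\<lparr>carrier := Y\<rparr>\<^esub> N) = \<Union>(rcosets\<^bsub>G\<lparr>carrier := E\<rparr>\<^esub> N)"
      by (rule arg_cong[OF sym])
    then show "Y = E" unfolding Union_rcosets_in[OF E Ns NE] Union_rcosets_in[OF Y(1) Ns NY] .
  qed
next
  have Ns: "subgroup N G" using N by (rule normal_imp_subgroup)
  assume R: ?R
  show ?L unfolding pi_maximal_def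
  proof (intro conjI notI)
    show "pi_subgroup \<pi> (G Mod N) (rcosets\<^bsub>G\<lparr>carrier := E\<rparr>\<^esub> N)"
      using R pi_subgroup_factor_iff[OF N E NE] by (auto simp: pi_max_over_def)
    assume "\<exists>Q. pi_subgroup \<pi> (G Mod N) Q \<and> rcosets\<^bsub>G\<lparr>carrier := E\<rparr>\<^esub> N \<subset> Q"
    then obtain Q where Q: "pi_subgroup \<pi> (G Mod N) Q" "rcosets\<^bsub>G\<lparr>carrier := E\<rparr>\<^esub> N \<subset> Q" by blast
    have Qs: "subgroup Q (G Mod N)" using Q(1) by (simp add: pi_subgroup_def)
    define Y where "Y = \<Union>Q"
    have Y: "subgroup Y G" unfolding Y_def by (rule normal.factgroup_subgroup_union_subgroup[OF N Qs])
    have QY: "Q = rcosets\<^bsub>G\<lparr>carrier := Y\<rparr>\<^esub> N"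
      unfolding Y_def by (rule normal.factgroup_subgroup_union_factor[OF N Qs])
    have EY: "E \<subseteq> Y" using Q(2) Union_rcosets_in[OF E Ns NE] unfolding Y_def by blast
    have NY: "N \<subseteq> Y" using NE EY by auto
    have "\<forall>q. prime q \<longrightarrow> q \<notin> \<pi> \<longrightarrow> val q Y = val q N"
      using Q(1) pi_subgroup_factor_iff[OF N Y NY] QY by simp
    then have "Y = E" using R Y EY subgroup.subset[OF Y] by (simp add: pi_max_over_def)
    then show False using Q(2) QY by simp
  qed
qed

lemma pi_projector_iff:
  "pi_projector \<pi> G P \<longleftrightarrow>
    subgroup P G \<and> (\<forall>N. N \<lhd> G \<longrightarrow> pi_max_over \<pi> (carrier G) N (P <#> N))"
proof -
  have "pi_maximal \<pi> (G Mod N) (rcosets\<^bsub>G\<lparr>carrier := P <#> N\<rparr>\<^esub> N) \<longleftrightarrow>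
      pi_max_over \<pi> (carrier G) N (P <#> N)" if P: "subgroup P G" and N: "N \<lhd> G" for N
  proof (rule pi_maximal_factor_iff[OF N])
    have Ns: "subgroup N G" and norm: "carrier G \<subseteq> normalizing N"
      using N normal_iff_normalizing by auto
    have "subgroup (N <#> P) G"
      using subgroup_product_normalizing[OF Ns P] norm subgroup.subset[OF P] by blast
    with permute_swap[OF Ns P this] show "subgroup (P <#> N) G" by simp
    show "N \<subseteq> P <#> N" by (rule subset_product_right[OF P subgroup.subset[OF Ns]])
  qed
  then show ?thesis unfolding pi_projector_def by blast
qed

lemma pi_projector_max_over:
  "pi_projector \<pi> G P \<Longrightarrow> N \<lhd> G \<Longrightarrow> pi_max_over \<pi> (carrier G) N (P <#> N)"
  unfolding pi_projector_iff by simp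

lemma conj_subset_eq_conjugate: "x \<in> carrier G \<Longrightarrow> conj_subset G P x = conjugate (inv x) P"
  by (force simp: conj_subset_def conjugate_def l_coset_def r_coset_def)

lemma pi_max_over_conjugate:
  assumes N: "N \<lhd> G" and g: "g \<in> carrier G" and E: "pi_max_over \<pi> (carrier G) N E"
  shows "pi_max_over \<pi> (carrier G) N (conjugate g E)"
proof -
  have Es: "subgroup E G" and NE: "N \<subseteq> E" and
    vE: "\<And>q. prime q \<Longrightarrow> q \<notin> \<pi> \<Longrightarrow> val q E = val q N" and
    mE: "\<And>Y. subgroup Y G \<Longrightarrow> E \<subseteq> Y \<Longrightarrow> Y \<subseteq> carrier G \<Longrightarrow>
        (\<forall>q. prime q \<longrightarrow> q \<notin> \<pi> \<longrightarrow> val q Y = val q N) \<Longrightarrow> Y = E"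
    using E unfolding pi_max_over_def by auto
  have Ns: "subgroup N G" and norm: "carrier G \<subseteq> normalizing N" using N normal_iff_normalizing by auto
  have Ec: "E \<subseteq> carrier G" using Es subgroup.subset by blast
  have gN: "conjugate g N = N" using normalizing_conjugate_eq[OF subsetD[OF norm g] subgroup.subset[OF Ns]] .
  show ?thesis unfolding pi_max_over_def
  proof (intro conjI allI impI)
    show "subgroup (conjugate g E) G" by (rule subgroup_conjugate[OF g Es])
    show "N \<subseteq> conjugate g E" using conjugate_mono[OF NE, of g] gN by simp
    show "conjugate g E \<subseteq> carrier G" by (rule conjugate_closed[OF g Ec])
    show "val q (conjugate g E) = val q N" if "prime q" "q \<notin> \<pi>" for q
      using vE[OF that] card_conjugate[OF g Ec] by simp
    fix Y assume Y: "subgroup Y G" "conjugate g E \<subseteq> Y" "\<forall>q. prime q \<longrightarrow> q \<notin> \<pi> \<longrightarrow> val q Y = val q N"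
    have Yc: "Y \<subseteq> carrier G" using Y subgroup.subset by blast
    have g': "inv g \<in> carrier G" using g by simp
    have "conjugate (inv g) Y = E"
    proof (rule mE[OF subgroup_conjugate[OF g' Y(1)]])
      show "E \<subseteq> conjugate (inv g) Y" using conjugate_mono[OF Y(2), of "inv g"] conjugate_conjugate_inv(2)[OF g Ec] by simp
      show "conjugate (inv g) Y \<subseteq> carrier G" by (rule conjugate_closed[OF g' Yc])
      show "\<forall>q. prime q \<longrightarrow> q \<notin> \<pi> \<longrightarrow> val q (conjugate (inv g) Y) = val q N"
        using Y(3) card_conjugate[OF g' Yc] by simp
    qed
    then show "Y = conjugate g E" using conjugate_conjugate_inv(1)[OF g Yc] by simp
  qed
qed

lemma pi_projector_conjugate:
  assumes P: "pi_projector \<pi> G P" and g: "g \<in> carrier G"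
  shows "pi_projector \<pi> G (conjugate g P)"
  unfolding pi_projector_iff
proof (intro conjI allI impI)
  have Ps: "subgroup P G" using P by (simp add: pi_projector_def)
  show "subgroup (conjugate g P) G" by (rule subgroup_conjugate[OF g Ps])
  fix N assume N: "N \<lhd> G"
  have Ns: "subgroup N G" and norm: "carrier G \<subseteq> normalizing N" using N normal_iff_normalizing by auto
  have "conjugate g N = N" using normalizing_conjugate_eq[OF subsetD[OF norm g] subgroup.subset[OF Ns]] .
  then have "conjugate g (P <#> N) = conjugate g P <#> N"
    using conjugate_set_mult[OF g subgroup.subset[OF Ps] subgroup.subset[OF Ns]] by simp
  then show "pi_max_over \<pi> (carrier G) N (conjugate g P <#> N)"
    using pi_max_over_conjugate[OF N g pi_projector_max_over[OF P N]] by simp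
qed

lemma val_pi_projector:
  assumes "pi_projector \<pi> G P" "prime q" "q \<notin> \<pi>"
  shows "val q P = 0"
proof -
  have P: "subgroup P G" using assms(1) by (simp add: pi_projector_def)
  have "P <#> {\<one>} = P" using subgroup.subset[OF P] by (force simp: set_mult_def)
  then have "pi_max_over \<pi> (carrier G) {\<one>} P"
    using pi_projector_max_over[OF assms(1) one_is_normal] by simp
  then show ?thesis using assms(2,3) by (simp add: pi_max_over_def)
qed

text \<open>
  Let \<open>N\<close> be the normal closure of \<open>P\<close>. The image of \<open>P\<close> in \<open>G/N\<close> is trivial and yet a
  maximal \<open>\<pi>\<close>-subgroup, so \<open>G/N\<close> has no non-trivial \<open>\<pi>\<close>-subgroup.
\<close>

lemma pi_subgroup_in_closure_of_projector:
  assumes P: "pi_projector \<pi> G P" and X: "subgroup X G"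
    and vX: "\<And>q. prime q \<Longrightarrow> q \<notin> \<pi> \<Longrightarrow> val q X = 0"
  shows "X \<subseteq> generate G (\<Union>g\<in>carrier G. conjugate g P)"
proof -
  have Ps: "subgroup P G" using P by (simp add: pi_projector_def)
  have Pc: "P \<subseteq> carrier G" using subgroup.subset[OF Ps] .
  let ?T = "\<Union>g\<in>carrier G. conjugate g P"
  define N where "N = generate G ?T"
  have Tc: "?T \<subseteq> carrier G" using conjugate_closed Pc by blast
  have N: "N \<lhd> G" unfolding N_def
  proof (rule normal_generateI[OF Tc])
    fix h g assume "h \<in> ?T" and g: "g \<in> carrier G"
    then obtain k where k: "k \<in> carrier G" "h \<in> conjugate k P" by blast
    have "g \<otimes> h \<otimes> inv g \<in> conjugate g (conjugate k P)" using k(2) by (auto simp: conjugate_def)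
    then have "g \<otimes> h \<otimes> inv g \<in> conjugate (g \<otimes> k) P" using conjugate_conjugate[OF g k(1) Pc] by simp
    then show "g \<otimes> h \<otimes> inv g \<in> ?T" using g k(1) by blast
  qed
  have Ns: "subgroup N G" and norm: "carrier G \<subseteq> normalizing N" using N normal_iff_normalizing by auto
  have "P \<subseteq> ?T" using conjugate_one[OF Pc] by blast
  then have "P \<subseteq> N" unfolding N_def using generate.incl[of _ ?T G] by blast
  then have PN: "P <#> N = N"
    using product_subset_subgroup[OF Ns _ order_refl] subset_product_right[OF Ps subgroup.subset[OF Ns]]
    by blast
  have NX: "subgroup (N <#> X) G"
    using subgroup_product_normalizing[OF Ns X] norm subgroup.subset[OF X] by blast
  have NsubNX: "N \<subseteq> N <#> X" by (rule subset_product_left[OF X subgroup.subset[OF Ns]])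
  have v: "val q (N <#> X) = val q N" if "prime q" "q \<notin> \<pi>" for q
    using val_product_le[OF Ns X that(1)] vX[OF that] val_mono[OF Ns NX NsubNX, of q] by simp
  have "pi_max_over \<pi> (carrier G) N N" using pi_projector_max_over[OF P N] PN by simp
  from pi_max_over_maximal[OF this NX NsubNX subgroup.subset[OF NX] v] have "N <#> X = N" .
  then show ?thesis using subset_product_right[OF Ns subgroup.subset[OF X]] unfolding N_def by simp
qed

section \<open>From the conjugates of one projector to all projectors\<close>

text \<open>
  The families to which \<open>permutes_with_projector\<close> is applied are \<open>C {i}\<close> and \<open>C (I - {i})\<close>, where \<open>C J\<close>
  collects the conjugates of the chosen projectors for the blocks in \<open>J\<close>.
\<close>

theorem sigma3_imp_sigma2:
  assumes part: "prime_partition I \<pi>" and H: "subgroup H G" and s3: "sigma3_permutable I \<pi> G H"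
  shows "sigma2_permutable I \<pi> G H"
  unfolding sigma2_permutable_def permutes_with_def
proof (intro ballI allI impI)
  fix i E assume i: "i \<in> I" and E: "pi_projector (\<pi> i) G E"
  have "\<forall>j\<in>I. \<exists>P. pi_projector (\<pi> j) G P \<and>
        (\<forall>x\<in>carrier G. H <#> conj_subset G P x = conj_subset G P x <#> H)"
    using s3 by (simp add: sigma3_permutable_def)
  then obtain P where P: "\<And>j. j \<in> I \<Longrightarrow> pi_projector (\<pi> j) G (P j)"
    "\<And>j x. j \<in> I \<Longrightarrow> x \<in> carrier G \<Longrightarrow> H <#> conj_subset G (P j) x = conj_subset G (P j) x <#> H"
    by metis
  have Ps: "subgroup (P j) G" if "j \<in> I" for j using P(1)[OF that] by (simp add: pi_projector_def)
  have HP: "H <#> conjugate g (P j) = conjugate g (P j) <#> H" if "j \<in> I" "g \<in> carrier G" for j g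
    using P(2)[OF that(1), of "inv g"] conj_subset_eq_conjugate[of "inv g" "P j"] that(2) by simp
  define C where "C J = (\<Union>j\<in>J. (\<lambda>g. conjugate g (P j)) ` carrier G)" for J
  have Cs: "subgroup Q G" if "Q \<in> C J" "J \<subseteq> I" for Q J
    using that Ps subgroup_conjugate unfolding C_def by blast
  have Ccj: "conjugate g Q \<in> C J" if Q: "Q \<in> C J" and "J \<subseteq> I" and g: "g \<in> carrier G" for Q J g
  proof -
    obtain j k where jk: "j \<in> J" "k \<in> carrier G" "Q = conjugate k (P j)" using Q unfolding C_def by blast
    have "P j \<subseteq> carrier G" using subgroup.subset[OF Ps] jk(1) \<open>J \<subseteq> I\<close> by blast
    then have "conjugate g Q = conjugate (g \<otimes> k) (P j)" unfolding jk(3) by (rule conjugate_conjugate[OF g jk(2)])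
    then show ?thesis using jk g unfolding C_def by blast
  qed
  have valC: "val q Q = 0" if Q: "Q \<in> C J" and J: "J \<subseteq> I" and q: "prime q" "q \<notin> \<Union>(\<pi> ` J)" for q Q J
  proof -
    obtain j k where jk: "j \<in> J" "k \<in> carrier G" "Q = conjugate k (P j)" using Q unfolding C_def by blast
    have j: "j \<in> I" using jk J by blast
    have "q \<notin> \<pi> j" using q jk by blast
    then have "val q (P j) = 0" using val_pi_projector[OF P(1)[OF j] q(1)] by simp
    then show ?thesis using card_conjugate[OF jk(2) subgroup.subset[OF Ps[OF j]]] jk(3) by simp
  qed
  have genC: "X \<subseteq> generate G (\<Union>(C J))" if J: "J \<subseteq> I" "j \<in> J" and X: "subgroup X G"
    "\<And>q. prime q \<Longrightarrow> q \<notin> \<pi> j \<Longrightarrow> val q X = 0" for J j X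
  proof -
    have "X \<subseteq> generate G (\<Union>g\<in>carrier G. conjugate g (P j))"
      using pi_subgroup_in_closure_of_projector[OF P(1) X] J by blast
    also have "\<dots> \<subseteq> generate G (\<Union>(C J))"
      by (rule mono_generate) (use J(2) in \<open>auto simp: C_def\<close>)
    finally show ?thesis .
  qed
  have genq: "x \<in> generate G (\<Union>(C J))"
    if J: "J \<subseteq> I" "j \<in> J" and q: "prime q" "q \<in> \<pi> j" and x: "q_element q x" for J j q x
  proof -
    have xc: "x \<in> carrier G" using x by (simp add: q_element_def)
    have "generate G {x} \<subseteq> generate G (\<Union>(C J))"
    proof (rule genC[OF J])
      show "subgroup (generate G {x}) G" using generate_is_subgroup xc by simp
      show "val p (generate G {x}) = 0" if "prime p" "p \<notin> \<pi> j" for p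
        using val_cyclic_q_element[OF x q(1) that(1)] that(2) q(2) by blast
    qed
    then show ?thesis using generate.incl[of x "{x}" G] by blast
  qed
  have iI: "{i} \<subseteq> I" "I - {i} \<subseteq> I" using i by auto
  have primes: "\<And>q. prime q \<Longrightarrow> \<exists>j\<in>I. q \<in> \<pi> j" using part unfolding prime_partition_def by blast
  have disj: "\<And>j q. j \<in> I \<Longrightarrow> j \<noteq> i \<Longrightarrow> q \<in> \<pi> i \<Longrightarrow> q \<notin> \<pi> j"
    using part i unfolding prime_partition_def disjoint_family_on_def by blast
  have Es: "subgroup E G" using E by (simp add: pi_projector_def)
  have vE: "\<And>q. prime q \<Longrightarrow> q \<notin> \<pi> i \<Longrightarrow> val q E = 0" by (rule val_pi_projector[OF E])
  show "subgroup (H <#> E) G"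
  proof (rule permutes_with_projector[of "C {i}" "C (I - {i})" "\<pi> i" H E, OF Cs[OF _ iI(1)] Cs[OF _ iI(2)]
        Ccj[OF _ iI(1)] Ccj[OF _ iI(2)] valC[OF _ iI(1)] valC[OF _ iI(2)] _ _ H _ Es vE])
    show "q \<notin> \<Union> (\<pi> ` {i})" if "q \<notin> \<pi> i" for q using that by simp
    show "q \<notin> \<Union> (\<pi> ` (I - {i}))" if "q \<in> \<pi> i" for q using disj that by blast
    show "x \<in> generate G (\<Union>(C {i}))" if "prime q" "q \<in> \<pi> i" "q_element q x" for q x
      using genq[OF iI(1) _ that] by simp
    show "x \<in> generate G (\<Union>(C (I - {i})))" if q: "prime q" "q \<notin> \<pi> i" "q_element q x" for q x
    proof -
      obtain j where "j \<in> I - {i}" "q \<in> \<pi> j" using primes[OF q(1)] q(2) by blast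
      then show ?thesis using genq[OF iI(2) _ q(1) _ q(3)] by blast
    qed
    show "H <#> Q = Q <#> H" if "Q \<in> C {i} \<union> C (I - {i})" for Q
      using that HP i unfolding C_def by blast
    show "E \<subseteq> generate G (\<Union>(C {i}))" using genC[OF iI(1) _ Es vE] by simp
    show "X \<subseteq> E <#> D" if D: "D \<lhd> G" and X: "subgroup X G" "E <#> D \<subseteq> X"
      and v: "\<And>q. prime q \<Longrightarrow> q \<notin> \<pi> i \<Longrightarrow> val q X = val q D" for D X
      using pi_max_over_maximal[OF pi_projector_max_over[OF E D] X subgroup.subset[OF X(1)] v] by simp
  qed
qed

section \<open>Fixed points of groups of prime power order\<close>

text \<open>
  The set counted is the union of those double cosets \<open>AxB\<close> that consist of more than one coset of \<open>B\<close>.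
  Such a double coset has \<open>\<bar>A : A \<inter> xBx\<^sup>-\<^sup>1\<bar> \<cdot> \<bar>B\<bar>\<close> elements, and the index is a
  non-trivial power of \<open>q\<close>. In other words, \<open>A\<close> acting on the cosets of \<open>B\<close> moves a multiple of
  \<open>q\<close> of them.
\<close>

lemma coset_fixed_points:
  assumes A: "subgroup A G" and B: "subgroup B G" and X: "subgroup X G" and AX: "A \<subseteq> X" and BX: "B \<subseteq> X"
    and q: "prime q" and cA: "card A = q ^ n"
  shows "q * card B dvd card {x \<in> X. \<not> conjugate (inv x) A \<subseteq> B}"
proof -
  have Ac: "A \<subseteq> carrier G" and Bc: "B \<subseteq> carrier G" and Xc: "X \<subseteq> carrier G"
    using A B X subgroup.subset by auto
  define N where "N = {x \<in> X. \<not> conjugate (inv x) A \<subseteq> B}"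
  define D where "D x = (\<lambda>(a, b). a \<otimes> x \<otimes> b) ` (A \<times> B)" for x
  have DI: "a \<otimes> x \<otimes> b \<in> D x" if "a \<in> A" "b \<in> B" for a b x using that by (auto simp: D_def)
  have self: "x \<in> D x" if "x \<in> X" for x
    using DI[OF subgroup.one_closed[OF A] subgroup.one_closed[OF B], of x] subsetD[OF Xc that] by simp
  have DX: "D x \<subseteq> X" if "x \<in> X" for x
  proof
    fix y assume "y \<in> D x"
    then obtain a b where "a \<in> A" "b \<in> B" "y = a \<otimes> x \<otimes> b" by (auto simp: D_def)
    then show "y \<in> X"
      using subgroup.m_closed[OF X subgroup.m_closed[OF X subsetD[OF AX] that] subsetD[OF BX]] by simp
  qed
  have Dsub: "D y \<subseteq> D x" if x: "x \<in> X" and y: "y \<in> D x" for x y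
  proof -
    obtain a b where ab: "a \<in> A" "b \<in> B" "y = a \<otimes> x \<otimes> b" using y by (auto simp: D_def)
    show ?thesis
    proof
      fix z assume "z \<in> D y"
      then obtain a' b' where ab': "a' \<in> A" "b' \<in> B" "z = a' \<otimes> y \<otimes> b'" by (auto simp: D_def)
      have c: "a \<in> carrier G" "b \<in> carrier G" "a' \<in> carrier G" "b' \<in> carrier G" "x \<in> carrier G"
        using ab ab' Ac Bc Xc x by auto
      have "z = (a' \<otimes> a) \<otimes> x \<otimes> (b \<otimes> b')" using ab(3) ab'(3) c by (simp add: m_assoc)
      then show "z \<in> D x"
        using DI[OF subgroup.m_closed[OF A ab'(1) ab(1)] subgroup.m_closed[OF B ab(2) ab'(2)]] by simp
    qed
  qed
  have Dsym: "x \<in> D y" if x: "x \<in> X" and y: "y \<in> D x" for x y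
  proof -
    obtain a b where ab: "a \<in> A" "b \<in> B" "y = a \<otimes> x \<otimes> b" using y by (auto simp: D_def)
    have c: "a \<in> carrier G" "b \<in> carrier G" "x \<in> carrier G" using ab Ac Bc Xc x by auto
    have "inv a \<otimes> y \<otimes> inv b = x" using ab(3) c by (simp add: m_assoc) (simp add: m_assoc[symmetric])
    then show ?thesis
      using DI[OF subgroup.m_inv_closed[OF A ab(1)] subgroup.m_inv_closed[OF B ab(2)], of y] by simp
  qed
  have Deq: "D y = D x" if "x \<in> X" "y \<in> D x" for x y
    using Dsub[OF that] Dsub[OF _ Dsym[OF that]] DX that by blast
  have DN: "D x \<subseteq> N" if xN: "x \<in> N" for x
  proof
    have x: "x \<in> X" using xN by (simp add: N_def)
    fix y assume y: "y \<in> D x"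
    have yX: "y \<in> X" using DX[OF x] y by blast
    obtain a b where ab: "a \<in> A" "b \<in> B" "y = a \<otimes> x \<otimes> b" using y by (auto simp: D_def)
    have c: "a \<in> carrier G" "b \<in> carrier G" "x \<in> carrier G" using ab Ac Bc Xc x by auto
    have c': "inv a \<in> carrier G" "inv b \<in> carrier G" "inv x \<in> carrier G" using c by auto
    have "conjugate (inv a) A = A"
      using normalizing_conjugate_eq[OF subsetD[OF subgroup_subset_normalizing[OF A] subgroup.m_inv_closed[OF A ab(1)]] Ac] .
    moreover have "inv y = inv b \<otimes> (inv x \<otimes> inv a)"
      using ab(3) c by (simp add: inv_mult_group m_assoc)
    ultimately have "conjugate (inv y) A = conjugate (inv b) (conjugate (inv x) A)"
      using conjugate_conjugate[OF c'(2) m_closed[OF c'(3,1)] Ac] conjugate_conjugate[OF c'(3,1) Ac] by simp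
    moreover have "conjugate b B = B"
      using normalizing_conjugate_eq[OF subsetD[OF subgroup_subset_normalizing[OF B] ab(2)] Bc] .
    ultimately have "conjugate (inv x) A \<subseteq> B" if "conjugate (inv y) A \<subseteq> B"
      using conjugate_mono[OF that, of b] conjugate_conjugate_inv(1)[OF c(2) conjugate_closed[OF c'(3) Ac]] by simp
    then show "y \<in> N" using xN yX by (auto simp: N_def)
  qed
  have cardD: "q * card B dvd card (D x)" if xN: "x \<in> N" for x
  proof -
    have x: "x \<in> carrier G" using xN Xc by (auto simp: N_def)
    have xB: "subgroup (conjugate x B) G" by (rule subgroup_conjugate[OF x B])
    have xBc: "conjugate x B \<subseteq> carrier G" by (rule conjugate_closed[OF x Bc])
    let ?I = "A \<inter> conjugate x B"
    have I: "subgroup ?I G" by (rule subgroup_inter[OF A xB])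
    have "D x = (\<lambda>y. y \<otimes> x) ` (A <#> conjugate x B)"
    proof -
      have "a \<otimes> x \<otimes> b = a \<otimes> (x \<otimes> b \<otimes> inv x) \<otimes> x" if "a \<in> A" "b \<in> B" for a b
        using subsetD[OF Ac that(1)] subsetD[OF Bc that(2)] x by (simp add: m_assoc)
      then have "D x = (\<lambda>(a, b). a \<otimes> (x \<otimes> b \<otimes> inv x) \<otimes> x) ` (A \<times> B)"
        unfolding D_def by (intro image_cong) auto
      also have "\<dots> = (\<lambda>y. y \<otimes> x) ` (A <#> conjugate x B)"
        by (force simp: set_mult_def conjugate_def)
      finally show ?thesis .
    qed
    moreover have "inj_on (\<lambda>y. y \<otimes> x) (A <#> conjugate x B)"
    proof (rule inj_onI)
      fix y z assume "y \<in> A <#> conjugate x B" "z \<in> A <#> conjugate x B" "y \<otimes> x = z \<otimes> x"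
      then show "y = z" using setmult_subset_G[OF Ac xBc] x by (metis subsetD right_cancel)
    qed
    ultimately have cD: "card (D x) = card (A <#> conjugate x B)" by (simp add: card_image)
    have prod: "card (D x) * card ?I = q ^ n * card B"
      using card_subgroup_product[OF A xB] card_conjugate[OF x Bc] cA cD by simp
    have "card ?I dvd q ^ n" using card_dvd_subgroup[OF I A] cA by simp
    then obtain m where m: "m \<le> n" "card ?I = q ^ m" using divides_primepow_nat[OF q] by blast
    have "m \<noteq> n"
    proof
      assume "m = n"
      then have "?I = A" using m(2) cA card_subset_eq[OF finite_subgroup[OF A], of ?I] by simp
      then have "conjugate (inv x) A \<subseteq> conjugate (inv x) (conjugate x B)" by (intro conjugate_mono) blast
      then show False using conjugate_conjugate_inv(2)[OF x Bc] xN by (simp add: N_def)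
    qed
    then obtain k where k: "n = m + Suc k" using m(1) less_iff_Suc_add[of m n] by auto
    have "card (D x) * q ^ m = (q * card B * q ^ k) * q ^ m"
      using prod m(2) by (simp add: k power_add mult_ac)
    then have "card (D x) = q * card B * q ^ k" using prime_gt_0_nat[OF q] by simp
    then show ?thesis by simp
  qed
  have "q * card B dvd card (\<Union>(D ` N))"
  proof (rule dvd_partition)
    have U: "\<Union>(D ` N) = N" using DN self by (auto simp: N_def)
    have "finite N" using finite_subgroup[OF X] by (simp add: N_def)
    then show "finite (\<Union>(D ` N))" using U by simp
    show "\<forall>c\<in>D ` N. q * card B dvd card c" using cardD by blast
    show "\<forall>c1\<in>D ` N. \<forall>c2\<in>D ` N. c1 \<noteq> c2 \<longrightarrow> c1 \<inter> c2 = {}"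
    proof (intro ballI impI)
      fix c1 c2 assume "c1 \<in> D ` N" "c2 \<in> D ` N" "c1 \<noteq> c2"
      then obtain x y where xy: "x \<in> X" "c1 = D x" "y \<in> X" "c2 = D y" by (auto simp: N_def)
      show "c1 \<inter> c2 = {}"
      proof (rule ccontr)
        assume "c1 \<inter> c2 \<noteq> {}"
        then obtain z where "z \<in> D x" "z \<in> D y" using xy by blast
        then have "D x = D y" using Deq[OF xy(1)] Deq[OF xy(3)] by blast
        then show False using \<open>c1 \<noteq> c2\<close> xy by simp
      qed
    qed
  qed
  moreover have "\<Union>(D ` N) = N" using DN self by (auto simp: N_def)
  ultimately show ?thesis by (simp add: N_def)
qed

text \<open>
  If no coset of \<open>B\<close> in \<open>X\<close> were fixed by \<open>A\<close>, then \<open>q \<cdot> \<bar>B\<bar>\<close> would divide \<open>\<bar>X\<bar>\<close>.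
\<close>

lemma sylow_conjugate:
  assumes X: "subgroup X G" and A: "subgroup A G" "A \<subseteq> X" and B: "subgroup B G" "B \<subseteq> X"
    and q: "prime q" and cA: "card A = q ^ n" and cB: "card B = q ^ val q X"
  obtains x where "x \<in> X" "conjugate (inv x) A \<subseteq> B"
proof (rule ccontr)
  assume "\<not> thesis"
  then have "{x \<in> X. \<not> conjugate (inv x) A \<subseteq> B} = X" using that by blast
  then have "q ^ Suc (val q X) dvd card X"
    using coset_fixed_points[OF A(1) B(1) X A(2) B(2) q cA] cB by simp
  then have "Suc (val q X) \<le> val q X"
    using power_dvd_iff_le_multiplicity[of "card X" q "Suc (val q X)"] card_subgroup_pos[OF X]
      prime_gt_1_nat[OF q] by simp
  then show False by simp
qed

text \<open>
  For every \<open>g\<close>, the conjugate \<open>gSg\<^sup>-\<^sup>1\<close> is again a Sylow subgroup of \<open>N\<close>, so some \<open>x \<in> N\<close> takes it back to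
  \<open>S\<close>; then \<open>x\<^sup>-\<^sup>1g\<close> normalizes \<open>S\<close>.
\<close>

lemma frattini_argument:
  assumes N: "N \<lhd> G" and S: "subgroup S G" "S \<subseteq> N" and q: "prime q" and cS: "card S = q ^ val q N"
  shows "N <#> normalizing S = carrier G"
proof
  have Ns: "subgroup N G" and norm: "carrier G \<subseteq> normalizing N" using N normal_iff_normalizing by auto
  have Nc: "N \<subseteq> carrier G" and Sc: "S \<subseteq> carrier G" using Ns S(1) subgroup.subset by auto
  show "N <#> normalizing S \<subseteq> carrier G"
    by (rule setmult_subset_G[OF Nc normalizing_subset])
  show "carrier G \<subseteq> N <#> normalizing S"
  proof
    fix g assume g: "g \<in> carrier G"
    have "conjugate g S \<subseteq> N"
      using conjugate_mono[OF S(2), of g] normalizing_conjugate_eq[OF subsetD[OF norm g] Nc] by simp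
    moreover have "card (conjugate g S) = q ^ val q N" using card_conjugate[OF g Sc] cS by simp
    ultimately obtain x where x: "x \<in> N" "conjugate (inv x) (conjugate g S) \<subseteq> S"
      using sylow_conjugate[OF Ns subgroup_conjugate[OF g S(1)] _ S q _ cS] by blast
    have xc: "x \<in> carrier G" using x Nc by blast
    have "inv x \<otimes> g \<in> normalizing S"
      using x(2) conjugate_conjugate[of "inv x" g S] xc g Sc by (simp add: normalizing_iff)
    moreover have "g = x \<otimes> (inv x \<otimes> g)" using xc g by (simp add: m_assoc[symmetric])
    ultimately show "g \<in> N <#> normalizing S" using x(1) unfolding set_mult_def by blast
  qed
qed

text \<open>
  The elements that do not normalize \<open>M\<close> number a multiple of \<open>q \<cdot> \<bar>M\<bar> = \<bar>G\<bar>\<close>, and \<open>\<one>\<close> is not one of them.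
\<close>

lemma index_prime_normal:
  assumes q: "prime q" and S: "card (carrier G) = q ^ Suc n" and M: "subgroup M G" "card M = q ^ n"
  shows "M \<lhd> G"
proof -
  have "q * card M dvd card {x \<in> carrier G. \<not> conjugate (inv x) M \<subseteq> M}"
    using coset_fixed_points[OF M(1) M(1) subgroup_self subgroup.subset[OF M(1)] subgroup.subset[OF M(1)] q M(2)] .
  moreover have "card {x \<in> carrier G. \<not> conjugate (inv x) M \<subseteq> M} < card (carrier G)"
  proof (rule psubset_card_mono[OF fin])
    have "conjugate (inv \<one>) M \<subseteq> M" using conjugate_one[OF subgroup.subset[OF M(1)]] by simp
    then show "{x \<in> carrier G. \<not> conjugate (inv x) M \<subseteq> M} \<subset> carrier G" using one_closed by blast
  qed
  ultimately have "card {x \<in> carrier G. \<not> conjugate (inv x) M \<subseteq> M} = 0"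
    using S M(2) dvd_imp_le[of "q * card M"] by fastforce
  then have *: "{x \<in> carrier G. \<not> conjugate (inv x) M \<subseteq> M} = {}" by simp
  have "g \<in> normalizing M" if g: "g \<in> carrier G" for g
  proof -
    have "inv g \<in> carrier G" using g by simp
    then have "conjugate (inv (inv g)) M \<subseteq> M" using * by blast
    then show ?thesis using g by (simp add: normalizing_iff)
  qed
  then show ?thesis using M(1) by (auto simp: normal_iff_normalizing)
qed

lemma prime_order_comm_group:
  assumes "prime (card (carrier G))"
  shows "comm_group G"
proof -
  have "card (carrier G) \<noteq> 1" using assms by auto
  then have "carrier G \<noteq> {\<one>}" by auto
  then obtain x where x: "x \<in> carrier G" "x \<noteq> \<one>" using one_closed by blast
  have X: "subgroup (generate G {x}) G" using generate_is_subgroup x by simp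
  have xin: "x \<in> generate G {x}" using generate.incl[of x "{x}" G] by simp
  have "card (generate G {x}) dvd card (carrier G)"
    by (rule card_dvd_subgroup[OF X subgroup_self subgroup.subset[OF X]])
  moreover have "card (generate G {x}) \<noteq> 1"
  proof
    assume "card (generate G {x}) = 1"
    then obtain z where "generate G {x} = {z}" by (rule card_1_singletonE)
    then show False using xin subgroup.one_closed[OF X] x(2) by auto
  qed
  ultimately have "card (generate G {x}) = card (carrier G)"
    using assms prime_nat_iff by blast
  then have "generate G {x} = carrier G"
    using card_subset_eq[OF fin subgroup.subset[OF X]] by simp
  moreover have "generate G {x} = range (\<lambda>n::int. x [^] n)"
    unfolding generate_pow[OF x(1)] by auto
  ultimately have "carrier G = range (\<lambda>n::int. x [^] n)" by simp
  then have "cyclic_group G" using cyclic_group x(1) by blast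
  then show ?thesis by (rule cyclic_imp_abelian_group)
qed

text \<open>
  A subgroup of index \<open>q\<close>, which exists by Sylow's theorem, is normal with quotient of prime order, so
  it contains the derived subgroup.
\<close>

lemma derived_proper:
  assumes q: "prime q" and S: "card (carrier G) = q ^ Suc n"
  shows "derived G (carrier G) \<noteq> carrier G"
proof -
  obtain M where M: "subgroup M G" "card M = q ^ n"
    using sylow_thm[OF q is_group, of n q] S by (auto simp: order_def mult.commute)
  have Mn: "M \<lhd> G" by (rule index_prime_normal[OF q S M])
  have pos: "q ^ n > 0" using prime_gt_0_nat[OF q] by simp
  have "card (rcosets M) * q ^ n = q * q ^ n"
    using lagrange[OF M(1)] S M(2) by (simp add: order_def)
  then have "card (rcosets M) = q" using prime_gt_0_nat[OF q] by simp
  then have cq: "card (carrier (G Mod M)) = q" by (simp add: FactGroup_def)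
  have "finite (carrier (G Mod M))" using cq prime_gt_0_nat[OF q] by (simp add: card_ge_0_finite)
  then interpret F: finite_group "G Mod M"
    using normal.factorgroup_is_group[OF Mn] by (simp add: finite_group_def finite_group_axioms_def)
  have "comm_group (G Mod M)" by (rule F.prime_order_comm_group) (simp add: cq q)
  then have "derived G (carrier G) \<subseteq> M" by (rule derived_minimal[OF Mn])
  moreover have "card M < card (carrier G)"
    using M(2) S pos prime_gt_1_nat[OF q] by simp
  ultimately show ?thesis
    using card_mono[OF finite_subgroup[OF M(1)], of "derived G (carrier G)"] by auto
qed

section \<open>Supplements of normal subgroups\<close>

text \<open>
  The abelian case of the theorem of Schur and Zassenhaus, by averaging a cocycle. For a transversal \<open>T\<close>
  of the cosets of \<open>S\<close>, let \<open>s g t \<in> S\<close> measure the failure of \<open>g t\<close> to be a representative. The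
  product \<open>\<theta> g\<close> of all \<open>s g t\<close> is a crossed homomorphism from \<open>G\<close> to \<open>S\<close> that restricts on \<open>S\<close> to the
  power map with exponent \<open>\<bar>G : S\<bar>\<close>. That map is a bijection by coprimality, so the
  kernel of \<open>\<theta>\<close> meets every coset of \<open>S\<close> in exactly one element.
\<close>

theorem abelian_normal_complement:
  assumes S: "S \<lhd> G" and ab: "comm_group (G\<lparr>carrier := S\<rparr>)"
    and cop: "coprime (card S) (card (rcosets S))"
  obtains L where "subgroup L G" "L \<inter> S = {\<one>}" "S <#> L = carrier G"
proof -
  let ?Q = "G\<lparr>carrier := S\<rparr>"
  interpret Q: comm_group ?Q by (rule ab)
  have Ss: "subgroup S G" and norm: "carrier G \<subseteq> normalizing S" using S normal_iff_normalizing by auto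
  have Sc: "S \<subseteq> carrier G" using subgroup.subset[OF Ss] .
  have SC: "s \<in> carrier G" if "s \<in> S" for s using Sc that by blast
  have cjS: "g \<otimes> s \<otimes> inv g \<in> S" if "g \<in> carrier G" "s \<in> S" for g s
    using normalizingD[OF subsetD[OF norm that(1)] that(2)] .
  define \<rho> where "\<rho> x = (SOME y. y \<in> S #> x)" for x
  have \<rho>in: "\<rho> x \<in> S #> x" if "x \<in> carrier G" for x
    unfolding \<rho>_def using someI[of "\<lambda>y. y \<in> S #> x" x] rcos_self[OF that Ss] by blast
  have \<rho>ex: "\<exists>s\<in>S. \<rho> x = s \<otimes> x" if "x \<in> carrier G" for x
    using \<rho>in[OF that] by (auto simp: r_coset_def)
  have \<rho>c: "\<rho> x \<in> carrier G" if "x \<in> carrier G" for x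
    using \<rho>ex[OF that] that SC by auto
  have \<rho>s: "\<rho> (s \<otimes> x) = \<rho> x" if "s \<in> S" "x \<in> carrier G" for s x
  proof -
    have "S #> (s \<otimes> x) = S #> x"
      using coset_mult_assoc[OF Sc SC[OF that(1)] that(2)] coset_join2[OF SC[OF that(1)] Ss that(1)] by simp
    then show ?thesis by (simp add: \<rho>_def)
  qed
  define T where "T = \<rho> ` carrier G"
  have Tc: "T \<subseteq> carrier G" using \<rho>c by (auto simp: T_def)
  have finT: "finite T" by (simp add: T_def)
  have \<rho>T: "\<rho> t = t" if t: "t \<in> T" for t
  proof -
    obtain x where x: "x \<in> carrier G" "t = \<rho> x" using t by (auto simp: T_def)
    obtain s where "s \<in> S" "\<rho> x = s \<otimes> x" using \<rho>ex[OF x(1)] by blast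
    then show ?thesis using \<rho>s[of s x] x by simp
  qed
  have cT: "card T = card (rcosets S)"
  proof (rule bij_betw_same_card)
    show "bij_betw (\<lambda>t. S #> t) T (rcosets S)"
    proof (rule bij_betw_imageI)
      show "inj_on (\<lambda>t. S #> t) T"
        using \<rho>T by (intro inj_onI) (metis \<rho>_def)
      show "(\<lambda>t. S #> t) ` T = rcosets S"
      proof
        show "(\<lambda>t. S #> t) ` T \<subseteq> rcosets S" using Tc by (auto simp: RCOSETS_def)
        show "rcosets S \<subseteq> (\<lambda>t. S #> t) ` T"
        proof
          fix c assume "c \<in> rcosets S"
          then obtain x where x: "x \<in> carrier G" "c = S #> x" by (auto simp: RCOSETS_def)
          have "c = S #> \<rho> x" using repr_independence[OF \<rho>in[OF x(1)] x(1) Ss] x(2) by simp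
          then show "c \<in> (\<lambda>t. S #> t) ` T" using x(1) by (auto simp: T_def)
        qed
      qed
    qed
  qed
  define s where "s g t = g \<otimes> t \<otimes> inv (\<rho> (g \<otimes> t))" for g t
  have sS: "s g t \<in> S" if g: "g \<in> carrier G" and t: "t \<in> T" for g t
  proof -
    have c: "g \<otimes> t \<in> carrier G" using g t Tc by auto
    obtain u where u: "u \<in> S" "\<rho> (g \<otimes> t) = u \<otimes> (g \<otimes> t)" using \<rho>ex[OF c] by blast
    have "s g t = inv u"
      unfolding s_def u(2) using c SC[OF u(1)] by (simp add: inv_mult_group m_assoc[symmetric])
    then show ?thesis using subgroup.m_inv_closed[OF Ss u(1)] by simp
  qed
  have s_eq: "g \<otimes> t = s g t \<otimes> \<rho> (g \<otimes> t)" if g: "g \<in> carrier G" and t: "t \<in> T" for g t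
  proof -
    have c: "g \<otimes> t \<in> carrier G" using g t Tc by auto
    then show ?thesis unfolding s_def using \<rho>c[OF c] by (simp add: m_assoc)
  qed
  define \<theta> where "\<theta> g = finprod ?Q (s g) T" for g
  have \<theta>S: "\<theta> g \<in> S" if "g \<in> carrier G" for g
    unfolding \<theta>_def using Q.finprod_closed[of "s g" T] sS[OF that] by auto
  have cocycle_s: "s (g \<otimes> h) t = (g \<otimes> s h t \<otimes> inv g) \<otimes> s g (\<rho> (h \<otimes> t))"
    if g: "g \<in> carrier G" and h: "h \<in> carrier G" and t: "t \<in> T" for g h t
  proof -
    have tc: "t \<in> carrier G" using t Tc by blast
    define r where "r = \<rho> (h \<otimes> t)"
    have rT: "r \<in> T" using h tc by (auto simp: r_def T_def)
    have rc: "r \<in> carrier G" using rT Tc by blast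
    have c1: "s h t \<in> S" "s g r \<in> S" using sS g h t rT by auto
    note c = c1[THEN SC] g h tc rc
    have k: "g \<otimes> s h t \<otimes> inv g \<in> S" by (rule cjS[OF g c1(1)])
    have "g \<otimes> h \<otimes> t = g \<otimes> (s h t \<otimes> r)" using s_eq[OF h t] c by (simp add: m_assoc r_def)
    also have "\<dots> = (g \<otimes> s h t \<otimes> inv g) \<otimes> (g \<otimes> r)"
      using c by (simp add: m_assoc) (simp add: m_assoc[symmetric])
    finally have e: "g \<otimes> h \<otimes> t = (g \<otimes> s h t \<otimes> inv g) \<otimes> (g \<otimes> r)" .
    then have "\<rho> (g \<otimes> h \<otimes> t) = \<rho> (g \<otimes> r)" using \<rho>s[OF k, of "g \<otimes> r"] c by simp
    then show ?thesis
      unfolding s_def[of "g \<otimes> h"] using e c \<rho>c[of "g \<otimes> r"] unfolding r_def[symmetric]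
      by (simp add: s_def[of g r] m_assoc)
  qed
  have conj_prod: "finprod ?Q (\<lambda>t. g \<otimes> f t \<otimes> inv g) A = g \<otimes> finprod ?Q f A \<otimes> inv g"
    if g: "g \<in> carrier G" and f: "f \<in> A \<rightarrow> S" and A: "finite A" for g f and A :: "'a set"
    using A f
  proof (induction A rule: finite_induct)
    case empty
    then show ?case using g by simp
  next
    case (insert x F)
    have fx: "f x \<in> S" and fF: "f \<in> F \<rightarrow> S" using insert.prems by auto
    have pF: "finprod ?Q f F \<in> S" using Q.finprod_closed[of f F] fF by simp
    have "finprod ?Q (\<lambda>t. g \<otimes> f t \<otimes> inv g) (insert x F)
        = (g \<otimes> f x \<otimes> inv g) \<otimes> finprod ?Q (\<lambda>t. g \<otimes> f t \<otimes> inv g) F"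
      using Q.finprod_insert[OF insert.hyps, of "\<lambda>t. g \<otimes> f t \<otimes> inv g"] fF fx cjS[OF g] by (auto simp: Pi_def)
    also have "\<dots> = g \<otimes> (f x \<otimes> finprod ?Q f F) \<otimes> inv g"
      using insert.IH[OF fF] conj_distrib[OF g SC[OF fx] SC[OF pF]] by simp
    also have "f x \<otimes> finprod ?Q f F = finprod ?Q f (insert x F)"
      using Q.finprod_insert[OF insert.hyps, of f] fF fx by simp
    finally show ?case .
  qed
  have cocycle: "\<theta> (g \<otimes> h) = (g \<otimes> \<theta> h \<otimes> inv g) \<otimes> \<theta> g"
    if g: "g \<in> carrier G" and h: "h \<in> carrier G" for g h
  proof -
    \<comment> \<open>Multiplication by \<open>h\<close> permutes the transversal, so the factors \<open>s g (\<rho> (h \<otimes> t))\<close> have product \<open>\<theta> g\<close>.\<close>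
    define \<tau> where "\<tau> t = \<rho> (h \<otimes> t)" for t
    have \<tau>T: "\<tau> ` T \<subseteq> T" using Tc h by (auto simp: \<tau>_def T_def)
    have inj\<tau>: "inj_on \<tau> T"
    proof (rule inj_onI)
      fix t t' assume t: "t \<in> T" "t' \<in> T" "\<tau> t = \<tau> t'"
      have c: "t \<in> carrier G" "t' \<in> carrier G" using t Tc by auto
      define u where "u = inv (s h t') \<otimes> s h t"
      have uS: "u \<in> S"
        unfolding u_def using subgroup.m_closed[OF Ss subgroup.m_inv_closed[OF Ss sS[OF h t(2)]] sS[OF h t(1)]] .
      define v where "v = s h t \<otimes> inv (s h t')"
      have vS: "v \<in> S"
        unfolding v_def using subgroup.m_closed[OF Ss sS[OF h t(1)] subgroup.m_inv_closed[OF Ss sS[OF h t(2)]]] .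
      have sc: "s h t \<in> carrier G" "s h t' \<in> carrier G" using sS[OF h] t SC by auto
      have rc: "\<rho> (h \<otimes> t') \<in> carrier G" using \<rho>c h c by simp
      have "h \<otimes> t = s h t \<otimes> \<rho> (h \<otimes> t')" using s_eq[OF h t(1)] t(3) by (simp add: \<tau>_def)
      also have "\<dots> = v \<otimes> (s h t' \<otimes> \<rho> (h \<otimes> t'))"
        unfolding v_def using sc rc by (simp add: m_assoc) (simp add: m_assoc[symmetric])
      also have "\<dots> = v \<otimes> (h \<otimes> t')" using s_eq[OF h t(2)] by simp
      finally have e: "h \<otimes> t = v \<otimes> (h \<otimes> t')" .
      have vc: "v \<in> carrier G" using SC[OF vS] .
      have "t = inv h \<otimes> (h \<otimes> t)" using h c by (simp add: m_assoc[symmetric])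
      also have "\<dots> = (inv h \<otimes> v \<otimes> h) \<otimes> t'" unfolding e using h c vc by (simp add: m_assoc)
      finally have "t = (inv h \<otimes> v \<otimes> h) \<otimes> t'" .
      moreover have "inv h \<otimes> v \<otimes> h \<in> S" using cjS[of "inv h" v] h vS by simp
      ultimately have "\<rho> t = \<rho> t'" using \<rho>s[of "inv h \<otimes> v \<otimes> h" t'] c by simp
      then show "t = t'" using \<rho>T t by simp
    qed
    have im: "\<tau> ` T = T" using endo_inj_surj[OF finT \<tau>T inj\<tau>] .
    have "\<theta> (g \<otimes> h) = finprod ?Q (\<lambda>t. (g \<otimes> s h t \<otimes> inv g) \<otimes>\<^bsub>?Q\<^esub> s g (\<tau> t)) T"
      unfolding \<theta>_def
    proof (rule Q.finprod_cong')
      show "(\<lambda>t. (g \<otimes> s h t \<otimes> inv g) \<otimes>\<^bsub>?Q\<^esub> s g (\<tau> t)) \<in> T \<rightarrow> carrier ?Q"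
        using cjS[OF g sS[OF h]] sS[OF g] \<tau>T subgroup.m_closed[OF Ss] by (auto simp: Pi_def)
      show "s (g \<otimes> h) t = (g \<otimes> s h t \<otimes> inv g) \<otimes>\<^bsub>?Q\<^esub> s g (\<tau> t)" if "t \<in> T" for t
        using cocycle_s[OF g h that] by (simp add: \<tau>_def)
    qed simp
    also have "\<dots> = finprod ?Q (\<lambda>t. g \<otimes> s h t \<otimes> inv g) T \<otimes>\<^bsub>?Q\<^esub> finprod ?Q (\<lambda>t. s g (\<tau> t)) T"
      by (rule Q.finprod_multf) (use cjS[OF g sS[OF h]] sS[OF g] \<tau>T in auto)
    also have "finprod ?Q (\<lambda>t. g \<otimes> s h t \<otimes> inv g) T = g \<otimes> \<theta> h \<otimes> inv g"
      unfolding \<theta>_def by (rule conj_prod[OF g _ finT]) (use sS[OF h] in auto)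
    also have "finprod ?Q (\<lambda>t. s g (\<tau> t)) T = \<theta> g"
      unfolding \<theta>_def using Q.finprod_reindex[of "s g" \<tau> T] im inj\<tau> sS[OF g] by simp
    finally show ?thesis by simp
  qed
  have \<theta>pow: "\<theta> a = a [^] card T" if a: "a \<in> S" for a
  proof -
    have "\<theta> a = finprod ?Q (\<lambda>t. a) T"
      unfolding \<theta>_def
    proof (rule Q.finprod_cong')
      show "(\<lambda>t. a) \<in> T \<rightarrow> carrier ?Q" using a by simp
      fix t assume t: "t \<in> T"
      have tc: "t \<in> carrier G" using t Tc by blast
      show "s a t = a" unfolding s_def \<rho>s[OF a tc] \<rho>T[OF t] using SC[OF a] tc by (simp add: m_assoc)
    qed simp
    also have "\<dots> = a [^]\<^bsub>?Q\<^esub> card T" using Q.finprod_const[of a T] a by simp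
    finally show ?thesis by (simp add: nat_pow_consistent[symmetric])
  qed
  have powS: "a [^] card S = \<one>" if "a \<in> S" for a by (rule pow_card_eq_one[OF Ss that])
  have copT: "coprime (card T) (card S)" using cop cT by (simp add: coprime_commute)
  define L where "L = {g \<in> carrier G. \<theta> g = \<one>}"
  have Lmult: "g \<otimes> h \<in> L" if "g \<in> L" "h \<in> L" for g h
    using cocycle[of g h] that by (simp add: L_def)
  have \<theta>1: "\<theta> \<one> = \<one>" using \<theta>pow[OF subgroup.one_closed[OF Ss]] by simp
  have L: "subgroup L G"
  proof (rule subgroupI)
    show "L \<subseteq> carrier G" by (auto simp: L_def)
    show "L \<noteq> {}" using \<theta>1 by (auto simp: L_def)
    show "g \<otimes> h \<in> L" if "g \<in> L" "h \<in> L" for g h by (rule Lmult[OF that])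
    fix g assume g: "g \<in> L"
    have gc: "g \<in> carrier G" and g1: "\<theta> g = \<one>" using g by (auto simp: L_def)
    have ic: "inv g \<in> carrier G" using gc by simp
    have "\<theta> (inv g) = \<one>"
      using cocycle[OF ic gc] g1 gc \<theta>1 SC[OF \<theta>S[OF ic]] by simp
    then show "inv g \<in> L" using ic by (simp add: L_def)
  qed
  have LS: "L \<inter> S = {\<one>}"
  proof
    show "{\<one>} \<subseteq> L \<inter> S" using subgroup.one_closed[OF L] subgroup.one_closed[OF Ss] by simp
    show "L \<inter> S \<subseteq> {\<one>}"
    proof
      fix a assume a: "a \<in> L \<inter> S"
      then have ac: "a \<in> carrier G" and "a [^] card T = \<one>" "a [^] card S = \<one>"
        using \<theta>pow powS by (auto simp: L_def)
      then have "ord a dvd card T" "ord a dvd card S" using pow_eq_id[OF ac] by auto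
      then have "ord a = 1" using copT by (metis coprime_common_divisor_nat)
      then show "a \<in> {\<one>}" using ord_eq_1[OF ac] by simp
    qed
  qed
  have "carrier G \<subseteq> S <#> L"
  proof
    fix g assume g: "g \<in> carrier G"
    define b where "b = inv (\<theta> g)"
    have bS: "b \<in> S" unfolding b_def by (rule subgroup.m_inv_closed[OF Ss \<theta>S[OF g]])
    have bc: "b \<in> carrier G" using SC[OF bS] .
    \<comment> \<open>A coefficient of Bezout's identity gives a root \<open>a\<close> of \<open>b\<close> for the power map \<open>\<theta>\<close> on \<open>S\<close>.\<close>
    have "card T \<noteq> 0" using finT \<rho>c one_closed by (auto simp: T_def)
    then obtain k y where k: "card T * k = card S * y + 1"
      using bezout_nat[of "card T" "card S"] copT by auto
    have "b [^] (card T * k) = (b [^] card S) [^] y \<otimes> b"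
      unfolding k using bc by (simp add: nat_pow_pow)
    then have bk: "b [^] (k * card T) = b" using powS[OF bS] bc by (simp add: mult.commute)
    define a where "a = b [^] k"
    have aS: "a \<in> S" unfolding a_def using subgroup_int_pow_closed[OF Ss bS, of "int k"] by (simp add: int_pow_int)
    have ac: "a \<in> carrier G" using SC[OF aS] .
    have "\<theta> a = b" using \<theta>pow[OF aS] bk bc by (simp add: a_def nat_pow_pow)
    then have "\<theta> (a \<otimes> g) = (a \<otimes> \<theta> g \<otimes> inv a) \<otimes> b" using cocycle[OF ac g] by simp
    also have "a \<otimes> \<theta> g \<otimes> inv a = \<theta> g"
      using Q.m_comm[of a "\<theta> g"] aS \<theta>S[OF g] ac SC[OF \<theta>S[OF g]] by (simp add: m_assoc)
    also have "\<theta> g \<otimes> b = \<one>" unfolding b_def using SC[OF \<theta>S[OF g]] by simp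
    finally have "a \<otimes> g \<in> L" using ac g by (simp add: L_def)
    moreover have "g = inv a \<otimes> (a \<otimes> g)" using ac g by (simp add: m_assoc[symmetric])
    ultimately show "g \<in> S <#> L"
      using subgroup.m_inv_closed[OF Ss aS] unfolding set_mult_def by blast
  qed
  then have "S <#> L = carrier G" using setmult_subset_G[OF Sc subgroup.subset[OF L]] by blast
  then show ?thesis using that[OF L LS] by blast
qed

text \<open>
  The complement of \<open>S/C\<close> in \<open>G/C\<close>, for \<open>C\<close> the derived subgroup of \<open>S\<close>, pulls back to \<open>L\<close>. It is
  proper because \<open>S\<close>, having prime power order, is larger than \<open>C\<close>.
\<close>

lemma normal_sylow_proper_supplement:
  assumes S: "S \<lhd> G" and q: "prime q" and cS: "card S = q ^ Suc n" and ind: "\<not> q dvd card (rcosets S)"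
  obtains L where "subgroup L G" "L \<noteq> carrier G" "S <#> L = carrier G"
proof -
  have Ss: "subgroup S G" using S by (rule normal_imp_subgroup)
  have Sc: "S \<subseteq> carrier G" using subgroup.subset[OF Ss] .
  interpret S: finite_group "G\<lparr>carrier := S\<rparr>" by (rule finite_group_subgroup[OF Ss])
  define C where "C = derived G S"
  have dS: "derived (G\<lparr>carrier := S\<rparr>) S = C" unfolding C_def by (rule derived_consistent[OF order_refl Ss])
  have Cn: "C \<lhd> G" unfolding C_def by (rule derived_is_normal[OF S])
  have Cs: "subgroup C G" using Cn by (rule normal_imp_subgroup)
  have CS: "C \<subseteq> S" unfolding C_def by (rule derived_incl[OF order_refl Ss])
  have CneS: "C \<noteq> S" using S.derived_proper[OF q, of n] cS dS by simp
  let ?F = "G Mod C" and ?S = "rcosets\<^bsub>G\<lparr>carrier := S\<rparr>\<^esub> C"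
  have "finite (carrier ?F)" unfolding carrier_FactGroup by simp
  then interpret F: finite_group "G Mod C"
    using normal.factorgroup_is_group[OF Cn] by (simp add: finite_group_def finite_group_axioms_def)
  have Sn: "?S \<lhd> ?F" by (rule normality_factorization[OF Cn CS S])
  have SF: "subgroup ?S ?F" using Sn by (rule normal_imp_subgroup)
  have comm: "comm_group (?F\<lparr>carrier := ?S\<rparr>)"
  proof -
    have "(<#>\<^bsub>G\<lparr>carrier := S\<rparr>\<^esub>) = (<#>)" by (intro ext) (simp add: set_mult_def)
    then show ?thesis using S.derived_quot_is_comm_group dS by (simp add: FactGroup_def)
  qed
  have c1: "card ?S * card C = card S" by (rule card_rcosets_in[OF Ss Cs CS])
  have c2: "card (carrier ?F) * card C = card (carrier G)"
    using lagrange[OF Cs] by (simp add: FactGroup_def order_def)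
  have c3: "card (rcosets\<^bsub>?F\<^esub> ?S) * card ?S = card (carrier ?F)"
    using F.lagrange[OF SF] by (simp add: order_def)
  have c4: "card (rcosets S) * card S = card (carrier G)"
    using lagrange[OF Ss] by (simp add: order_def)
  have "card (rcosets\<^bsub>?F\<^esub> ?S) * card S = card (rcosets S) * card S"
    by (metis c1 c2 c3 c4 mult.assoc)
  then have ci: "card (rcosets\<^bsub>?F\<^esub> ?S) = card (rcosets S)" using card_subgroup_pos[OF Ss] by simp
  have "card ?S dvd q ^ Suc n" using c1 cS by (metis dvd_triv_left)
  then obtain m where "card ?S = q ^ m" using divides_primepow_nat[OF q] by blast
  then have cop: "coprime (card ?S) (card (rcosets\<^bsub>?F\<^esub> ?S))"
    unfolding ci using ind q by (simp add: prime_imp_coprime)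
  obtain L where L: "subgroup L ?F" "L \<inter> ?S = {\<one>\<^bsub>?F\<^esub>}" "?S <#>\<^bsub>?F\<^esub> L = carrier ?F"
    using F.abelian_normal_complement[OF Sn comm cop] by blast
  let ?L = "\<Union>L"
  have Ls: "subgroup ?L G" by (rule normal.factgroup_subgroup_union_subgroup[OF Cn L(1)])
  have Lch: "?L = {x \<in> carrier G. C #> x \<in> L}" by (rule normal.factgroup_subgroup_union_char[OF Cn L(1)])
  have "?L \<noteq> carrier G"
  proof
    assume LG: "?L = carrier G"
    have "C #> s = C" if "s \<in> S" for s
    proof -
      have "C #> s \<in> L" using Lch LG that Sc by blast
      moreover have "C #> s \<in> ?S" using that by (auto simp: RCOSETS_def)
      ultimately show ?thesis using L(2) by auto
    qed
    then have "S \<subseteq> C" using rcos_self[OF subsetD[OF Sc] Cs] by blast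
    then show False using CS CneS by blast
  qed
  moreover have "carrier G \<subseteq> S <#> ?L"
  proof
    fix x assume x: "x \<in> carrier G"
    then have "C #> x \<in> carrier ?F" by (simp add: carrier_FactGroup)
    then obtain A B where AB: "A \<in> ?S" "B \<in> L" "C #> x = A <#> B"
      unfolding L(3)[symmetric] by (auto simp: set_mult_def)
    obtain s where s: "s \<in> S" "A = C #> s" using AB(1) by (auto simp: RCOSETS_def)
    have "x \<in> A <#> B" using rcos_self[OF x Cs] AB(3) by simp
    then obtain a b where ab: "a \<in> A" "b \<in> B" "x = a \<otimes> b" by (auto simp: set_mult_def)
    obtain c where "c \<in> C" "a = c \<otimes> s" using ab(1) s(2) by (auto simp: r_coset_def)
    then have "a \<in> S" using subgroup.m_closed[OF Ss subsetD[OF CS] s(1)] by blast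
    then show "x \<in> S <#> ?L" using ab AB(2) unfolding set_mult_def by blast
  qed
  then have "S <#> ?L = carrier G" using setmult_subset_G[OF Sc subgroup.subset[OF Ls]] by blast
  ultimately show ?thesis using that[OF Ls] by blast
qed

lemma normalizing_restrict:
  assumes Y: "subgroup Y G"
  shows "finite_group.normalizing (G\<lparr>carrier := Y\<rparr>) L = Y \<inter> normalizing L"
proof -
  interpret Y: finite_group "G\<lparr>carrier := Y\<rparr>" by (rule finite_group_subgroup[OF Y])
  show ?thesis
    using m_inv_consistent[OF Y] subgroup.mem_carrier[OF Y]
    by (auto simp: Y.normalizing_def normalizing_def)
qed

lemma normal_restrict_iff:
  assumes Y: "subgroup Y G"
  shows "N \<lhd> G\<lparr>carrier := Y\<rparr> \<longleftrightarrow> subgroup N G \<and> N \<subseteq> Y \<and> Y \<subseteq> normalizing N"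
proof -
  interpret Y: finite_group "G\<lparr>carrier := Y\<rparr>" by (rule finite_group_subgroup[OF Y])
  show ?thesis
    unfolding Y.normal_iff_normalizing normalizing_restrict[OF Y] subgroup_of_subgroup_iff[OF Y] by auto
qed

text \<open>
  A supplement \<open>P\<close> of \<open>N\<close> of least order is a \<open>\<pi>\<close>-group. Otherwise some prime \<open>q \<notin> \<pi>\<close> divides its order.
  As \<open>G/N\<close> is a \<open>\<pi>\<close>-group, a Sylow \<open>q\<close>-subgroup \<open>S\<close> of \<open>N \<inter> P\<close> is one of \<open>P\<close> as well. The Frattini
  argument and minimality make \<open>S\<close> normal in \<open>P\<close>, and then \<open>S\<close> has a proper supplement in \<open>P\<close>, which is a
  smaller supplement of \<open>N\<close> in \<open>G\<close>.
\<close>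

theorem pi_supplement:
  assumes N: "N \<lhd> G" and v: "\<And>q. prime q \<Longrightarrow> q \<notin> \<pi> \<Longrightarrow> val q (carrier G) = val q N"
  obtains P where "subgroup P G" "\<And>q. prime q \<Longrightarrow> q \<notin> \<pi> \<Longrightarrow> val q P = 0" "N <#> P = carrier G"
proof -
  have Ns: "subgroup N G" and norm: "carrier G \<subseteq> normalizing N" using N normal_iff_normalizing by auto
  have Nc: "N \<subseteq> carrier G" using subgroup.subset[OF Ns] .
  let ?supp = "\<lambda>P. subgroup P G \<and> N <#> P = carrier G"
  have "?supp (carrier G)"
    using subgroup_self setmult_subset_G[OF Nc order_refl] subset_product_right[OF Ns order_refl] by blast
  then obtain P where "?supp P" and min: "\<And>L. ?supp L \<Longrightarrow> card P \<le> card L"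
    using ex_has_least_nat[of ?supp _ card] by blast
  then have P: "subgroup P G" and NP: "N <#> P = carrier G" by auto
  have Pc: "P \<subseteq> carrier G" using subgroup.subset[OF P] .
  \<comment> \<open>A supplement in \<open>P\<close> of a subgroup of \<open>N\<close> is a supplement of \<open>N\<close> in \<open>G\<close>, so it cannot be proper.\<close>
  have noL: "L = P" if L: "subgroup L G" "L \<subseteq> P" and A: "A \<subseteq> N" "A <#> L = P" for L A
  proof -
    have Lc: "L \<subseteq> carrier G" and Ac: "A \<subseteq> carrier G" using L Pc A Nc by auto
    have "carrier G = N <#> (A <#> L)" using NP A by simp
    also have "\<dots> = (N <#> A) <#> L" by (rule set_mult_assoc[symmetric, OF Nc Ac Lc])
    also have "\<dots> \<subseteq> N <#> L" by (rule mono_set_mult[OF product_subset_subgroup[OF Ns order_refl A(1)] order_refl])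
    finally have "N <#> L = carrier G" using setmult_subset_G[OF Nc Lc] by blast
    then have "card P \<le> card L" using min L(1) by blast
    then show ?thesis using card_seteq[OF finite_subgroup[OF P] L(2)] by blast
  qed
  define M where "M = N \<inter> P"
  have M: "subgroup M G" unfolding M_def by (rule subgroup_inter[OF Ns P])
  interpret P: finite_group "G\<lparr>carrier := P\<rparr>" by (rule finite_group_subgroup[OF P])
  have Mn: "M \<lhd> G\<lparr>carrier := P\<rparr>" unfolding M_def by (rule normal_Int_subgroup[OF P N])
  have "val q P = 0" if q: "prime q" "q \<notin> \<pi>" for q
  proof (rule ccontr)
    assume v0: "val q P \<noteq> 0"
    have vM: "val q M = val q P"
      using val_product[OF Ns P q(1)] NP v[OF q] unfolding M_def by simp
    obtain S where S: "subgroup S G" "S \<subseteq> M" "card S = q ^ val q M"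
      using sylow_exists[OF M q(1)] by blast
    have SP: "S \<subseteq> P" and SN: "S \<subseteq> N" using S(2) by (auto simp: M_def)
    have S': "subgroup S (G\<lparr>carrier := P\<rparr>)" using S(1) SP subgroup_of_subgroup_iff[OF P] by blast
    have "M <#> (P \<inter> normalizing S) = P"
      using P.frattini_argument[OF Mn S' S(2) q(1) S(3)] normalizing_restrict[OF P] by simp
    then have "P \<inter> normalizing S = P"
      by (intro noL[OF subgroup_inter[OF P subgroup_normalizing[OF subgroup.subset[OF S(1)]]]])
        (auto simp: M_def)
    then have Sn: "S \<lhd> G\<lparr>carrier := P\<rparr>"
      unfolding normal_restrict_iff[OF P] using S(1) SP by blast
    obtain n where n: "val q P = Suc n" using v0 not0_implies_Suc by blast
    have cS: "card S = q ^ Suc n" using S(3) vM n by simp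
    have "\<not> q dvd card (rcosets\<^bsub>G\<lparr>carrier := P\<rparr>\<^esub> S)"
    proof
      assume "q dvd card (rcosets\<^bsub>G\<lparr>carrier := P\<rparr>\<^esub> S)"
      then have "q * card S dvd card P" using card_rcosets_in[OF P S(1) SP] by (metis mult_dvd_mono dvd_refl)
      then have "q ^ Suc (Suc n) dvd card P" using cS by simp
      then have "Suc (Suc n) \<le> val q P"
        using power_dvd_iff_le_multiplicity[of "card P" q "Suc (Suc n)"] card_subgroup_pos[OF P]
          prime_gt_1_nat[OF q(1)] by simp
      then show False using n by simp
    qed
    then obtain L where L: "subgroup L (G\<lparr>carrier := P\<rparr>)" "L \<noteq> P" "S <#> L = P"
      using P.normal_sylow_proper_supplement[OF Sn q(1) cS] by auto
    then show False
      using noL[OF _ _ SN L(3)] L(1) subgroup_of_subgroup_iff[OF P] by blast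
  qed
  then show ?thesis using that[OF P _ NP] by blast
qed

section \<open>Existence of projectors\<close>

lemma pi_max_over_exists:
  assumes E0: "subgroup E0 G" "N \<subseteq> E0" "E0 \<subseteq> X"
    and v: "\<And>q. prime q \<Longrightarrow> q \<notin> \<pi> \<Longrightarrow> val q E0 = val q N"
  obtains E where "pi_max_over \<pi> X N E" "E0 \<subseteq> E"
proof -
  let ?c = "\<lambda>E. subgroup E G \<and> E0 \<subseteq> E \<and> E \<subseteq> X \<and> (\<forall>q. prime q \<longrightarrow> q \<notin> \<pi> \<longrightarrow> val q E = val q N)"
  have "\<exists>E. ?c E \<and> (\<forall>Y. ?c Y \<longrightarrow> card Y \<le> card E)"
  proof (rule ex_has_greatest_nat)
    show "?c E0" using E0 v by simp
    show "\<forall>E. ?c E \<longrightarrow> card E < Suc (card (carrier G))"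
      using card_mono[OF fin subgroup.subset] by (simp add: less_Suc_eq_le)
  qed
  then obtain E where E: "?c E" "\<forall>Y. ?c Y \<longrightarrow> card Y \<le> card E" by (elim exE conjE) (rule that, simp_all)
  have "pi_max_over \<pi> X N E" unfolding pi_max_over_def
  proof (intro conjI allI impI)
    show "subgroup E G" "N \<subseteq> E" "E \<subseteq> X" using E(1) E0(2) by auto
    show "val q E = val q N" if "prime q" "q \<notin> \<pi>" for q using E(1) that by simp
    fix Y assume Y: "subgroup Y G" "E \<subseteq> Y" "Y \<subseteq> X" "\<forall>q. prime q \<longrightarrow> q \<notin> \<pi> \<longrightarrow> val q Y = val q N"
    then have "card Y \<le> card E" using E by auto
    then show "Y = E" using card_seteq[OF finite_subgroup[OF Y(1)] Y(2)] by simp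
  qed
  then show ?thesis using that E(1) by blast
qed

text \<open>
  For \<open>K\<close> normal in \<open>X\<close> this says that \<open>E/K\<close> is a \<open>\<pi>\<close>-projector of \<open>X/K\<close>.
\<close>

definition section_projector :: "nat set \<Rightarrow> 'a set \<Rightarrow> 'a set \<Rightarrow> 'a set \<Rightarrow> bool" where
  "section_projector \<pi> X K E \<longleftrightarrow> subgroup E G \<and> K \<subseteq> E \<and> E \<subseteq> X \<and>
     (\<forall>N. subgroup N G \<longrightarrow> K \<subseteq> N \<longrightarrow> N \<subseteq> X \<longrightarrow> X \<subseteq> normalizing N \<longrightarrow> pi_max_over \<pi> X N (E <#> N))"

lemma section_projectorD:
  assumes "section_projector \<pi> X K E" "subgroup N G" "K \<subseteq> N" "N \<subseteq> X" "X \<subseteq> normalizing N"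
  shows "pi_max_over \<pi> X N (E <#> N)"
  using assms unfolding section_projector_def by blast

lemma product_absorb_right:
  assumes "subgroup X G" "subgroup N G" "N \<subseteq> X" shows "X <#> N = X"
  using product_subset_subgroup[OF assms(1) order_refl assms(3)]
    subset_product_left[OF assms(2) subgroup.subset[OF assms(1)]] by blast

lemma product_absorb_left:
  assumes "subgroup X G" "subgroup N G" "N \<subseteq> X" shows "N <#> X = X"
  using product_subset_subgroup[OF assms(1) assms(3) order_refl]
    subset_product_right[OF assms(2) subgroup.subset[OF assms(1)]] by blast

lemma product_swap_normalizing:
  assumes H: "subgroup H G" and K: "subgroup K G" and n: "K \<subseteq> normalizing H"
  shows "K <#> H = H <#> K" and "subgroup (K <#> H) G"
proof -
  have s: "subgroup (H <#> K) G" by (rule subgroup_product_normalizing[OF H K n])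
  show e: "K <#> H = H <#> K" by (rule permute_swap[OF H K s, symmetric])
  show "subgroup (K <#> H) G" using s e by simp
qed

lemma normalizing_inter:
  "X \<subseteq> normalizing A \<Longrightarrow> X \<subseteq> normalizing B \<Longrightarrow> X \<subseteq> normalizing (A \<inter> B)"
  by (auto simp: normalizing_def)

lemma normalizing_product:
  assumes "A \<subseteq> carrier G" "B \<subseteq> carrier G" "X \<subseteq> normalizing A" "X \<subseteq> normalizing B"
  shows "X \<subseteq> normalizing (A <#> B)"
proof
  fix x assume x: "x \<in> X"
  have xc: "x \<in> carrier G" using x assms(3) normalizing_subset by blast
  have "conjugate x (A <#> B) = A <#> B"
    using conjugate_set_mult[OF xc assms(1,2)] normalizing_conjugate_eq[OF subsetD[OF assms(3) x] assms(1)]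
      normalizing_conjugate_eq[OF subsetD[OF assms(4) x] assms(2)] by simp
  then show "x \<in> normalizing (A <#> B)" using xc by (simp add: normalizing_iff)
qed

text \<open>
  Let \<open>Y/K1\<close> be a \<open>\<pi>\<close>-subgroup of \<open>X/K1\<close> containing the image of \<open>F\<close>. Modulo \<open>N K1\<close> the group \<open>Y\<close> contains
  the image of \<open>E = F N\<close>, which is maximal, so \<open>Y \<subseteq> E K1\<close> and hence \<open>Y = (Y \<inter> E) K1\<close>. Now
  \<open>Y \<inter> E\<close> is a \<open>\<pi>\<close>-group modulo \<open>E \<inter> K1\<close>, and as \<open>F\<close> is a projector of \<open>E\<close>, it equals \<open>F (E \<inter> K1)\<close>.
\<close>

lemma section_projector_trans:
  assumes X: "subgroup X G"
    and N: "subgroup N G" "K \<subseteq> N" "N \<subseteq> X" "X \<subseteq> normalizing N"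
    and K: "subgroup K G" "X \<subseteq> normalizing K"
    and E: "section_projector \<pi> X N E" and F: "section_projector \<pi> E K F"
  shows "section_projector \<pi> X K F"
  unfolding section_projector_def
proof (intro conjI allI impI)
  have Es: "subgroup E G" "N \<subseteq> E" "E \<subseteq> X" using E by (auto simp: section_projector_def)
  have Fs: "subgroup F G" "K \<subseteq> F" "F \<subseteq> E" using F by (auto simp: section_projector_def)
  show "subgroup F G" "K \<subseteq> F" "F \<subseteq> X" using Fs Es by auto
  have KE: "K \<subseteq> E" using Fs by auto
  have vE: "val q E = val q N" if "prime q" "q \<notin> \<pi>" for q
    using section_projectorD[OF E N(1) order_refl N(3,4)] product_absorb_right[OF Es(1) N(1) Es(2)] that
    by (simp add: pi_max_over_def)
  have vF: "val q F = val q K" if "prime q" "q \<notin> \<pi>" for q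
    using section_projectorD[OF F K(1) order_refl KE] product_absorb_right[OF Fs(1) K(1) Fs(2)] that Es(3) K(2)
    by (simp add: pi_max_over_def)
  have FN: "E = F <#> N"
    by (rule pi_max_over_maximal[OF section_projectorD[OF F N(1,2) Es(2)] Es(1) _ order_refl vE])
      (use Es Fs N(4) product_subset_subgroup[OF Es(1) Fs(3) Es(2)] in auto)
  fix K1 assume K1: "subgroup K1 G" "K \<subseteq> K1" "K1 \<subseteq> X" "X \<subseteq> normalizing K1"
  have Fnorm: "F \<subseteq> normalizing K1" using Fs Es K1 by blast
  have FK1: "subgroup (F <#> K1) G" by (rule product_swap_normalizing(2)[OF K1(1) Fs(1) Fnorm])
  have K1sub: "K1 \<subseteq> F <#> K1" by (rule subset_product_right[OF Fs(1) subgroup.subset[OF K1(1)]])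
  show "pi_max_over \<pi> X K1 (F <#> K1)" unfolding pi_max_over_def
  proof (intro conjI allI impI)
    show "subgroup (F <#> K1) G" by (rule FK1)
    show "K1 \<subseteq> F <#> K1" by (rule K1sub)
    show "F <#> K1 \<subseteq> X" by (rule product_subset_subgroup[OF X _ K1(3)]) (use Fs Es in auto)
    show "val q (F <#> K1) = val q K1" if q: "prime q" "q \<notin> \<pi>" for q
    proof (rule antisym)
      have "val q K \<le> val q (F \<inter> K1)"
        by (rule val_mono[OF K(1) subgroup_inter[OF Fs(1) K1(1)]]) (use Fs(2) K1(2) in auto)
      then show "val q (F <#> K1) \<le> val q K1"
        using val_product[OF Fs(1) K1(1) q(1)] vF[OF q] by simp
      show "val q K1 \<le> val q (F <#> K1)" by (rule val_mono[OF K1(1) FK1 K1sub])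
    qed
    fix Y assume Y: "subgroup Y G" "F <#> K1 \<subseteq> Y" "Y \<subseteq> X"
      and vY: "\<forall>q. prime q \<longrightarrow> q \<notin> \<pi> \<longrightarrow> val q Y = val q K1"
    have K1Y: "K1 \<subseteq> Y" using K1sub Y(2) by blast
    have FY: "F \<subseteq> Y" using subset_product_left[OF K1(1) subgroup.subset[OF Fs(1)]] Y(2) by blast
    have NK: "subgroup (N <#> K1) G"
      by (rule product_swap_normalizing(2)[OF K1(1) N(1)]) (use N K1 in blast)
    have NKX: "N <#> K1 \<subseteq> X" by (rule product_subset_subgroup[OF X N(3) K1(3)])
    have NNK: "N \<subseteq> N <#> K1" by (rule subset_product_left[OF K1(1) subgroup.subset[OF N(1)]])
    have K1NK: "K1 \<subseteq> N <#> K1" by (rule subset_product_right[OF N(1) subgroup.subset[OF K1(1)]])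
    have normNK: "X \<subseteq> normalizing (N <#> K1)"
      by (rule normalizing_product[OF subgroup.subset[OF N(1)] subgroup.subset[OF K1(1)] N(4) K1(4)])
    have maxNK: "pi_max_over \<pi> X (N <#> K1) (E <#> (N <#> K1))"
      by (rule section_projectorD[OF E NK NNK NKX normNK])
    have YN: "subgroup (Y <#> N) G"
      by (rule product_swap_normalizing(2)[OF N(1) Y(1)]) (use N Y in blast)
    have YsubYN: "Y \<subseteq> Y <#> N" by (rule subset_product_left[OF N(1) subgroup.subset[OF Y(1)]])
    have NsubYN: "N \<subseteq> Y <#> N" by (rule subset_product_right[OF Y(1) subgroup.subset[OF N(1)]])
    have NKYN: "N <#> K1 \<subseteq> Y <#> N"
      by (rule product_subset_subgroup[OF YN NsubYN]) (use K1Y YsubYN in blast)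
    have "E \<subseteq> Y <#> N"
      unfolding FN by (rule product_subset_subgroup[OF YN _ NsubYN]) (use FY YsubYN in blast)
    then have sub: "E <#> (N <#> K1) \<subseteq> Y <#> N" by (rule product_subset_subgroup[OF YN _ NKYN])
    have "Y <#> N = E <#> (N <#> K1)"
    proof (rule pi_max_over_maximal[OF maxNK YN sub])
      show "Y <#> N \<subseteq> X" by (rule product_subset_subgroup[OF X Y(3) N(3)])
      fix q :: nat assume q: "prime q" "q \<notin> \<pi>"
      show "val q (Y <#> N) = val q (N <#> K1)"
      proof (rule antisym)
        have "val q (N \<inter> K1) \<le> val q (Y \<inter> N)"
          by (rule val_mono[OF subgroup_inter[OF N(1) K1(1)] subgroup_inter[OF Y(1) N(1)]]) (use K1Y in auto)
        then show "val q (Y <#> N) \<le> val q (N <#> K1)"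
          using val_product[OF Y(1) N(1) q(1)] val_product[OF N(1) K1(1) q(1)] vY q by simp
        show "val q (N <#> K1) \<le> val q (Y <#> N)" by (rule val_mono[OF NK YN NKYN])
      qed
    qed
    also have "\<dots> = (E <#> N) <#> K1"
      by (rule set_mult_assoc[symmetric])
        (use subgroup.subset[OF Es(1)] subgroup.subset[OF N(1)] subgroup.subset[OF K1(1)] in auto)
    also have "\<dots> = E <#> K1" using product_absorb_right[OF Es(1) N(1) Es(2)] by simp
    finally have YEK: "Y \<subseteq> E <#> K1" using YsubYN by simp
    define Z where "Z = Y \<inter> E"
    define K2 where "K2 = E \<inter> K1"
    have Z: "subgroup Z G" unfolding Z_def by (rule subgroup_inter[OF Y(1) Es(1)])
    have K2: "subgroup K2 G" unfolding K2_def by (rule subgroup_inter[OF Es(1) K1(1)])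
    \<comment> \<open>Dedekind's law, in the form \<open>Y \<inter> E K1 = (Y \<inter> E) K1\<close> for \<open>K1 \<subseteq> Y\<close>.\<close>
    have YZ: "Z <#> K1 = Y"
    proof
      show "Z <#> K1 \<subseteq> Y" by (rule product_subset_subgroup[OF Y(1) _ K1Y]) (auto simp: Z_def)
      show "Y \<subseteq> Z <#> K1"
      proof
        fix y assume y: "y \<in> Y"
        then obtain e k where ek: "e \<in> E" "k \<in> K1" "y = e \<otimes> k" using YEK unfolding set_mult_def by blast
        have c: "e \<in> carrier G" "k \<in> carrier G"
          using subgroup.mem_carrier[OF Es(1) ek(1)] subgroup.mem_carrier[OF K1(1) ek(2)] .
        have "y \<otimes> inv k \<in> Y"
          using subgroup.m_closed[OF Y(1) y subsetD[OF K1Y subgroup.m_inv_closed[OF K1(1) ek(2)]]] .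
        then have "e \<in> Z" using ek c by (simp add: Z_def m_assoc)
        then show "y \<in> Z <#> K1" using ek unfolding set_mult_def by blast
      qed
    qed
    have maxK2: "pi_max_over \<pi> E K2 (F <#> K2)"
      by (rule section_projectorD[OF F K2])
        (use KE K1(2,4) Es(3) normalizing_inter[OF subgroup_subset_normalizing[OF Es(1)], of K1] in \<open>auto simp: K2_def\<close>)
    have "Z = F <#> K2"
    proof (rule pi_max_over_maximal[OF maxK2 Z])
      show "F <#> K2 \<subseteq> Z"
        by (rule product_subset_subgroup[OF Z]) (use FY Fs K1Y in \<open>auto simp: Z_def K2_def\<close>)
      show "Z \<subseteq> E" by (auto simp: Z_def)
      fix q :: nat assume q: "prime q" "q \<notin> \<pi>"
      have "Z \<inter> K1 = K2" using K1Y by (auto simp: Z_def K2_def)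
      then show "val q Z = val q K2" using val_product[OF Z K1(1) q(1)] YZ vY q by simp
    qed
    then have "Y = (F <#> K2) <#> K1" using YZ by simp
    also have "\<dots> = F <#> (K2 <#> K1)"
      by (rule set_mult_assoc)
        (use subgroup.subset[OF Fs(1)] subgroup.subset[OF K2] subgroup.subset[OF K1(1)] in auto)
    also have "K2 <#> K1 = K1" by (rule product_absorb_left[OF K1(1) K2]) (auto simp: K2_def)
    finally show "Y = F <#> K1" .
  qed
qed

lemma section_projector_self:
  assumes X: "subgroup X G" and K: "subgroup K G" "K \<subseteq> X"
    and v: "\<And>q. prime q \<Longrightarrow> q \<notin> \<pi> \<Longrightarrow> val q X = val q K"
  shows "section_projector \<pi> X K X"
  unfolding section_projector_def
proof (intro conjI allI impI)
  show "subgroup X G" "K \<subseteq> X" "X \<subseteq> X" using X K by auto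
  fix N assume N: "subgroup N G" "K \<subseteq> N" "N \<subseteq> X"
  have "val q X = val q N" if "prime q" "q \<notin> \<pi>" for q
    using v[OF that] val_mono[OF K(1) N(1,2), of q] val_mono[OF N(1) X N(3), of q] by simp
  then show "pi_max_over \<pi> X N (X <#> N)"
    unfolding product_absorb_right[OF X N(1,3)] using X N by (auto simp: pi_max_over_def)
qed

text \<open>
  If some \<open>N\<close> gives a proper quotient \<open>X/N\<close> of \<open>X/K\<close> that is not a \<open>\<pi>\<close>-group, a projector \<open>E/N\<close> of \<open>X/N\<close> has
  \<open>E \<noteq> X\<close>, and the induction hypothesis for \<open>E/K\<close> applies. Otherwise there is a least normal subgroup \<open>N\<close>
  with \<open>X/N\<close> a \<open>\<pi>\<close>-group, and a maximal \<open>\<pi>\<close>-subgroup of \<open>X/K\<close> containing a \<open>\<pi>\<close>-supplement of \<open>N\<close>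
  covers all proper quotients of \<open>X/K\<close>.
\<close>

lemma section_projector_exists:
  assumes "subgroup X G" "subgroup K G" "K \<subseteq> X" "X \<subseteq> normalizing K"
  shows "\<exists>E. section_projector \<pi> X K E"
  using assms
proof (induction "card X - card K" arbitrary: X K rule: less_induct)
  case less
  note X = less.prems(1) and K = less.prems(2-4)
  have finX: "finite X" using finite_subgroup[OF X] .
  define big where "big N \<longleftrightarrow> (\<forall>q. prime q \<longrightarrow> q \<notin> \<pi> \<longrightarrow> val q X = val q N)" for N :: "'a set"
  show ?case
  proof (cases "big K")
    case True
    then show ?thesis using section_projector_self[OF X K(1,2), of \<pi>] by (auto simp: big_def)
  next
    case notbigK: False
    have KX: "K \<noteq> X" using notbigK by (auto simp: big_def)
    show ?thesis
    proof (cases "\<exists>N. subgroup N G \<and> K \<subset> N \<and> N \<subseteq> X \<and> X \<subseteq> normalizing N \<and> \<not> big N")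
      case True
      then obtain N where N: "subgroup N G" "K \<subset> N" "N \<subseteq> X" "X \<subseteq> normalizing N" "\<not> big N" by blast
      have "card K < card N" by (rule psubset_card_mono[OF finite_subgroup[OF N(1)] N(2)])
      moreover have "card N \<le> card X" by (rule card_mono[OF finX N(3)])
      ultimately have "card X - card N < card X - card K" by simp
      then obtain E where E: "section_projector \<pi> X N E" using less.hyps[OF _ X N(1,3,4)] by blast
      have Es: "subgroup E G" "N \<subseteq> E" "E \<subseteq> X" using E by (auto simp: section_projector_def)
      have "val q E = val q N" if "prime q" "q \<notin> \<pi>" for q
        using section_projectorD[OF E N(1) order_refl N(3,4)] product_absorb_right[OF Es(1) N(1) Es(2)] that
        by (simp add: pi_max_over_def)
      then have "E \<noteq> X" using N(5) by (auto simp: big_def)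
      then have "card E < card X" using psubset_card_mono[OF finX] Es(3) by blast
      moreover have "card K \<le> card E" by (rule card_mono[OF finite_subgroup[OF Es(1)]]) (use N(2) Es in blast)
      ultimately have "card E - card K < card X - card K" by simp
      then obtain F where F: "section_projector \<pi> E K F"
        using less.hyps[OF _ Es(1) K(1)] K(3) N(2) Es by blast
      have "section_projector \<pi> X K F"
        by (rule section_projector_trans[OF X N(1) _ N(3,4) K(1,3) E F]) (use N(2) in blast)
      then show ?thesis by blast
    next
      case False
      then have allbig: "big N" if "subgroup N G" "K \<subset> N" "N \<subseteq> X" "X \<subseteq> normalizing N" for N
        using that by blast
      let ?c = "\<lambda>N. subgroup N G \<and> K \<subseteq> N \<and> N \<subseteq> X \<and> X \<subseteq> normalizing N \<and> big N"
      have "?c X" using X K(2) subgroup_subset_normalizing[OF X] by (auto simp: big_def)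
      then obtain N where cN: "?c N" and min: "\<And>M. ?c M \<Longrightarrow> card N \<le> card M"
        using ex_has_least_nat[of ?c X card] by blast
      have N: "subgroup N G" "K \<subseteq> N" "N \<subseteq> X" "X \<subseteq> normalizing N" "big N" using cN by auto
      \<comment> \<open>Normal subgroups with \<open>\<pi>\<close>-quotient are closed under intersection, so one of least order is least.\<close>
      have least: "N \<subseteq> M" if M: "?c M" for M
      proof -
        have Ms: "subgroup M G" "K \<subseteq> M" "M \<subseteq> X" "X \<subseteq> normalizing M" "big M" using M by auto
        have NM: "subgroup (N \<inter> M) G" by (rule subgroup_inter[OF N(1) Ms(1)])
        have prodX: "subgroup (N <#> M) G"
          by (rule subgroup_product_normalizing[OF N(1) Ms(1)]) (use Ms N in blast)
        have "val q X = val q (N \<inter> M)" if q: "prime q" "q \<notin> \<pi>" for q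
        proof (rule antisym)
          have "val q (N <#> M) \<le> val q X"
            by (rule val_mono[OF prodX X product_subset_subgroup[OF X N(3) Ms(3)]])
          moreover have "val q X = val q N" "val q X = val q M" using N(5) Ms(5) q by (auto simp: big_def)
          ultimately show "val q X \<le> val q (N \<inter> M)" using val_product[OF N(1) Ms(1) q(1)] by simp
          show "val q (N \<inter> M) \<le> val q X" by (rule val_mono[OF NM X]) (use N(3) in blast)
        qed
        then have "?c (N \<inter> M)"
          using NM N Ms normalizing_inter[OF N(4) Ms(4)] by (auto simp: big_def)
        then have "card N \<le> card (N \<inter> M)" by (rule min)
        then have "N \<inter> M = N" using card_seteq[OF finite_subgroup[OF N(1)], of "N \<inter> M"] by simp
        then show ?thesis by blast
      qed
      interpret XG: finite_group "G\<lparr>carrier := X\<rparr>" by (rule finite_group_subgroup[OF X])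
      have Nn: "N \<lhd> G\<lparr>carrier := X\<rparr>" unfolding normal_restrict_iff[OF X] using N by blast
      obtain P where "subgroup P (G\<lparr>carrier := X\<rparr>)" and vP: "\<And>q. prime q \<Longrightarrow> q \<notin> \<pi> \<Longrightarrow> val q P = 0"
        and NP: "N <#> P = X"
      proof (rule XG.pi_supplement[OF Nn, of \<pi>])
        show "val q (carrier (G\<lparr>carrier := X\<rparr>)) = val q N" if "prime q" "q \<notin> \<pi>" for q
          using N(5) that by (simp add: big_def)
      qed simp
      then have P: "subgroup P G" "P \<subseteq> X" using subgroup_of_subgroup_iff[OF X] by auto
      have PK: "subgroup (K <#> P) G"
        by (rule subgroup_product_normalizing[OF K(1) P(1)]) (use P K in blast)
      have KPK: "K \<subseteq> K <#> P" by (rule subset_product_left[OF P(1) subgroup.subset[OF K(1)]])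
      have PPK: "P \<subseteq> K <#> P" by (rule subset_product_right[OF K(1) subgroup.subset[OF P(1)]])
      have vPK: "val q (K <#> P) = val q K" if q: "prime q" "q \<notin> \<pi>" for q
        using val_product_le[OF K(1) P(1) q(1)] vP[OF q] val_mono[OF K(1) PK KPK, of q] by simp
      obtain E where E: "pi_max_over \<pi> X K E" "K <#> P \<subseteq> E"
        using pi_max_over_exists[OF PK KPK product_subset_subgroup[OF X K(2) P(2)] vPK] by blast
      have Es: "subgroup E G" "K \<subseteq> E" "E \<subseteq> X" using E(1) by (auto simp: pi_max_over_def)
      have "section_projector \<pi> X K E" unfolding section_projector_def
      proof (intro conjI allI impI)
        show "subgroup E G" "K \<subseteq> E" "E \<subseteq> X" using Es by auto
        fix N1 assume N1: "subgroup N1 G" "K \<subseteq> N1" "N1 \<subseteq> X" "X \<subseteq> normalizing N1"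
        show "pi_max_over \<pi> X N1 (E <#> N1)"
        proof (cases "N1 = K")
          case True then show ?thesis using product_absorb_right[OF Es(1) K(1) Es(2)] E(1) by simp
        next
          case False
          have b: "big N1" by (rule allbig[OF N1(1) _ N1(3,4)]) (use N1(2) False in blast)
          have "N \<subseteq> N1" by (rule least) (use N1 b in blast)
          have s: "N1 <#> E = E <#> N1" "subgroup (E <#> N1) G"
            using product_swap_normalizing[OF N1(1) Es(1)] N1(4) Es(3) by auto
          have "X \<subseteq> N1 <#> E"
            unfolding NP[symmetric] by (rule mono_set_mult[OF \<open>N \<subseteq> N1\<close>]) (use PPK E(2) in blast)
          then have "E <#> N1 = X"
            using product_subset_subgroup[OF X Es(3) N1(3)] s(1) by blast
          then show ?thesis using b X N1 by (auto simp: pi_max_over_def big_def)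
        qed
      qed
      then show ?thesis by blast
    qed
  qed
qed

theorem pi_projector_exists: "\<exists>P. pi_projector \<pi> G P"
proof -
  have one: "subgroup {\<one>} G" "carrier G \<subseteq> normalizing {\<one>}"
    using one_is_normal normal_iff_normalizing by auto
  obtain E where E: "section_projector \<pi> (carrier G) {\<one>} E"
    using section_projector_exists[OF subgroup_self one(1) _ one(2)] by auto
  have "pi_max_over \<pi> (carrier G) N (E <#> N)" if "N \<lhd> G" for N
    using section_projectorD[OF E, of N] that subgroup.one_closed[of N G] subgroup.subset[of N G]
    unfolding normal_iff_normalizing by auto
  then have "pi_projector \<pi> G E"
    using E unfolding pi_projector_iff by (simp add: section_projector_def)
  then show ?thesis by blast
qed

theorem sigma2_imp_sigma3:
  assumes H: "subgroup H G" and s2: "sigma2_permutable I \<pi> G H"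
  shows "sigma3_permutable I \<pi> G H"
  unfolding sigma3_permutable_def
proof
  fix i assume i: "i \<in> I"
  obtain P where P: "pi_projector (\<pi> i) G P" using pi_projector_exists by blast
  have Ps: "subgroup P G" using P by (simp add: pi_projector_def)
  have "H <#> conj_subset G P x = conj_subset G P x <#> H" if x: "x \<in> carrier G" for x
  proof -
    have x': "inv x \<in> carrier G" using x by simp
    have "subgroup (H <#> conjugate (inv x) P) G"
      using s2 i pi_projector_conjugate[OF P x'] by (simp add: sigma2_permutable_def permutes_with_def)
    from permute_swap[OF H subgroup_conjugate[OF x' Ps] this] show ?thesis
      using conj_subset_eq_conjugate[OF x] by simp
  qed
  then show "\<exists>P. pi_projector (\<pi> i) G P \<and> (\<forall>x\<in>carrier G. H <#> conj_subset G P x = conj_subset G P x <#> H)"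
    using P by blast
qed

end

section \<open>The equivalence\<close>

theorem theorem1:
  fixes G :: "('a, 'b) monoid_scheme"
    and H :: "'a set"
    and I :: "'i set"
    and \<pi> :: "'i \<Rightarrow> nat set"
  assumes "prime_partition I \<pi>"
    and "group G"
    and "finite (carrier G)"
    and "subgroup H G"
  shows "sigma3_permutable I \<pi> G H \<longleftrightarrow> sigma2_permutable I \<pi> G H"
proof -
  interpret finite_group G using assms(2,3) by (simp add: finite_group_def finite_group_axioms_def)
  show ?thesis
    using sigma3_imp_sigma2[OF assms(1,4)] sigma2_imp_sigma3[OF assms(4)] by blast
qed

end
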